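(* For every integer $N\ge 1$ there are threshold numbers $k_1^\star=k_1^\star(N)$ and $k_2^\star=k_2^\star(N)$ with $k_1^\star<k_2^\star$ such that the following threshold stopping time is optimal, i.e. attains the supremum $$v_N=\sup_{\tau\in\mathfrak M^N}\mathbf E\left[\frac{T_\tau-\tau}{N}\right]:$$ it immediately selects a relatively best object (relative rank $1$) if it appears on or after time $k_1^\star$, and immediately selects a relatively second best object (relative rank $2$) if it appears after time $k_2^\star$; that is, it stops at the first time $k$ with ($Y_k=1$ and $k\ge k_1^\star$) or ($Y_k=2$ and $k>k_2^\star$), and at time $N$ if there is no such $k$. Moreover, these thresholds satisfy, as $N\to\infty$, $$\frac{k_1^\star}{N}\to a\cong 0.120381,\qquad \frac{k_2^\star}{N}\to b\cong 0.417188,\qquad v_N\to v\cong 0.403827,$$ so that the asymptotic mean duration (shelf life) of the selected object is $0.403827\,N$.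
   Context: Let $X_1,\dots,X_N$ be a uniformly random permutation of $\{1,\dots,N\}$ on a probability space $(\Omega,\mathcal F,\mathbf P)$; $X_k$ is the absolute rank of the $k$-th object (rank $1$ is best). The relative rank of the $k$-th object is $Y_k=\#\{1\le i\le k: X_i\le X_k\}$. The $Y_k$ are independent and $\mathbf P\{Y_k=i\}=1/k$ for $1\le i\le k$. Let $\mathcal F_k=\sigma(Y_1,\dots,Y_k)$ and let $\mathfrak M^N$ be the set of stopping times $\tau$ with values in $\{1,\dots,N\}$ with respect to $(\mathcal F_k)_{k=1}^N$. An object observed so far is called a candidate as long as it is the best or the second best among the objects observed so far. For $1\le i\le N$, $T_i$ is the moment at which the $i$-th object stops being a candidate: $$T_i=\min\{k: i\le k\le N,\ \#\{1\le j\le k: X_j<X_i\}\ge 2\},$$ with $T_i=N+1$ if there is no such $k$. (Thus $T_i=i$, i.e. duration zero, if $Y_i\ge 3$.) The duration of the object selected at time $i$ is $T_i-i$, and the payoff of a stopping time $\tau$ is $(T_\tau-\tau)/N$. The symbol $\cong$ means that the real number on the left, rounded to six decimals, is the number on the right. *)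

theory Defs
  imports "HOL-Probability.Probability" "HOL-Probability.Stopping_Time"
begin

text \<open>
  A random sequence is curried as \<^term>\<open>X k \<omega>\<close>: the absolute rank (1 is best) of the
  \<open>k\<close>-th object, for \<open>1 \<le> k \<le> N\<close>. Values of \<^term>\<open>X\<close> at other indices are irrelevant.
\<close>

definition uniform_random_permutation ::
    "'a measure \<Rightarrow> nat \<Rightarrow> (nat \<Rightarrow> 'a \<Rightarrow> nat) \<Rightarrow> bool" where
  "uniform_random_permutation M N X \<longleftrightarrow>
     prob_space M \<and>
     (\<forall>k\<in>{1..N}. X k \<in> measurable M (count_space UNIV)) \<and>
     (\<forall>\<omega>\<in>space M. bij_betw (\<lambda>k. X k \<omega>) {1..N} {1..N}) \<and>
     (\<forall>p. p permutes {1..N} \<longrightarrow>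
        measure M {\<omega> \<in> space M. \<forall>k\<in>{1..N}. X k \<omega> = p k} = 1 / fact N)"

definition relative_rank :: "(nat \<Rightarrow> 'a \<Rightarrow> nat) \<Rightarrow> nat \<Rightarrow> 'a \<Rightarrow> nat" where
  "relative_rank X k \<omega> = card {i \<in> {1..k}. X i \<omega> \<le> X k \<omega>}"

definition rank_filtration ::
    "'a measure \<Rightarrow> (nat \<Rightarrow> 'a \<Rightarrow> nat) \<Rightarrow> nat \<Rightarrow> 'a measure" where
  "rank_filtration M X k =
     sigma (space M) {relative_rank X i -` A \<inter> space M | i A. i \<in> {1..k}}"

text \<open>
  The filtration is indexed by all of \<^typ>\<open>nat\<close>, but for times bounded by \<open>N\<close> the stopping
  time condition is automatic at indices \<open>k \<ge> N\<close>.
\<close>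

definition stopping_times ::
    "'a measure \<Rightarrow> nat \<Rightarrow> (nat \<Rightarrow> 'a \<Rightarrow> nat) \<Rightarrow> ('a \<Rightarrow> nat) set" where
  "stopping_times M N X =
     {\<tau>. stopping_time (rank_filtration M X) \<tau> \<and> (\<forall>\<omega>\<in>space M. \<tau> \<omega> \<in> {1..N})}"

definition end_of_candidacy :: "nat \<Rightarrow> (nat \<Rightarrow> 'a \<Rightarrow> nat) \<Rightarrow> nat \<Rightarrow> 'a \<Rightarrow> nat" where
  "end_of_candidacy N X i \<omega> =
     (if \<exists>k\<in>{i..N}. card {j \<in> {1..k}. X j \<omega> < X i \<omega>} \<ge> 2
      then (LEAST k. k \<in> {i..N} \<and> card {j \<in> {1..k}. X j \<omega> < X i \<omega>} \<ge> 2)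
      else N + 1)"

definition payoff :: "nat \<Rightarrow> (nat \<Rightarrow> 'a \<Rightarrow> nat) \<Rightarrow> ('a \<Rightarrow> nat) \<Rightarrow> 'a \<Rightarrow> real" where
  "payoff N X \<tau> \<omega> =
     (real (end_of_candidacy N X (\<tau> \<omega>) \<omega>) - real (\<tau> \<omega>)) / real N"

definition optimal_value :: "'a measure \<Rightarrow> nat \<Rightarrow> (nat \<Rightarrow> 'a \<Rightarrow> nat) \<Rightarrow> real" where
  "optimal_value M N X =
     (SUP \<tau>\<in>stopping_times M N X. integral\<^sup>L M (payoff N X \<tau>))"

definition optimal_stopping_time ::
    "'a measure \<Rightarrow> nat \<Rightarrow> (nat \<Rightarrow> 'a \<Rightarrow> nat) \<Rightarrow> ('a \<Rightarrow> nat) \<Rightarrow> bool" where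
  "optimal_stopping_time M N X \<tau> \<longleftrightarrow>
     \<tau> \<in> stopping_times M N X \<and> integral\<^sup>L M (payoff N X \<tau>) = optimal_value M N X"

definition threshold_selects ::
    "(nat \<Rightarrow> 'a \<Rightarrow> nat) \<Rightarrow> nat \<Rightarrow> nat \<Rightarrow> nat \<Rightarrow> 'a \<Rightarrow> bool" where
  "threshold_selects X k1 k2 k \<omega> \<longleftrightarrow>
     relative_rank X k \<omega> = 1 \<and> k \<ge> k1 \<or> relative_rank X k \<omega> = 2 \<and> k > k2"

definition threshold_time ::
    "nat \<Rightarrow> (nat \<Rightarrow> 'a \<Rightarrow> nat) \<Rightarrow> nat \<Rightarrow> nat \<Rightarrow> 'a \<Rightarrow> nat" where
  "threshold_time N X k1 k2 \<omega> =
     (if \<exists>k\<in>{1..N}. threshold_selects X k1 k2 k \<omega>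
      then (LEAST k. k \<in> {1..N} \<and> threshold_selects X k1 k2 k \<omega>)
      else N)"

definition rounds_to_six_decimals :: "real \<Rightarrow> real \<Rightarrow> bool" (infix "\<cong>\<^sub>6" 50) where
  "x \<cong>\<^sub>6 y \<longleftrightarrow> real_of_int (round (10 ^ 6 * x)) / 10 ^ 6 = y"

end

theory Submission
  imports Defs
begin

text \<open>
  The problem is an optimal stopping problem for the independent relative ranks. Write
  \<open>H\<^sub>k\<close> for the harmonic numbers. Given that the object at time \<open>k\<close> has relative rank 2,
  respectively 1, its expected duration is
  \<open>s\<^sub>k = k (N + 1 - k) / N\<close>, respectively \<open>b\<^sub>k = 2 k (H\<^sub>N - H\<^bsub>k-1\<^esub>) - s\<^sub>k\<close>; an object of larger
  relative rank is worthless. This is because the number of better objects seen so far evolves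
  as a Markov chain driven by the next relative rank (\<open>expected_time_as_candidate\<close>).
  Hence the value \<open>V\<^sub>k\<close> of continuing after time \<open>k\<close> solves a Bellman recursion
  (\<open>cont_value\<close>), and the usual supermartingale comparison shows that a stopping time is optimal
  as soon as it stops only where the reward is at least \<open>V\<close> and continues only where it is
  at most \<open>V\<close> (\<open>bellman_step\<close>).

  That these regions are given by thresholds is seen by comparing \<open>V\<close> with the values of two
  explicit strategies, each of which is a lower bound for \<open>V\<close>. Stopping at every later candidate
  yields \<open>w\<^sub>k\<close> (\<open>greedy_value\<close>), and \<open>b\<^sub>k = s\<^sub>k + w\<^sub>k\<close>. The function
  \<open>(N / k) (s\<^sub>k - w\<^sub>k)\<close> has increments \<open>2 N / k - 3\<close>, which decrease, and it is positive at
  the end; so \<open>s\<^sub>k \<ge> w\<^sub>k\<close> holds exactly from some time on, and from there on \<open>V = w\<close>. Before that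
  time a second best object is rejected, and the strategy to compare with waits for a relatively
  best object until \<open>k\<^sub>2\<close> and is greedy afterwards (\<open>best_only_value\<close>). If \<open>u\<^sub>k\<close> is its value,
  \<open>(b\<^sub>k - u\<^sub>k) / k\<close> has increments \<open>(b\<^bsub>k+1\<^esub> - b\<^sub>k) / k\<close>, and \<open>b\<close> is concave; so again
  the stopping region for rank 1 is an interval ending at \<open>k\<^sub>2\<close>. Below \<open>k\<^sub>1\<close> nothing is accepted
  and \<open>V\<close> is constant.

  For the limits, \<open>w\<close> and \<open>u\<close> have closed forms in harmonic numbers, and \<open>H\<^sub>N - H\<^sub>k\<close> tends to
  \<open>- ln x\<close> when \<open>k / N\<close> tends to \<open>x\<close>. The threshold conditions become
  \<open>3 (1 - b) + 2 ln b = 0\<close> and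
  \<open>(ln a)\<^sup>2 + 3 ln a - 2 a + 2 = (ln b)\<^sup>2 + ln b\<close>. The first function is monotone
  near its root, and so is the difference of the two sides of the second; this forces the
  convergence of \<open>k\<^sub>2 / N\<close> and \<open>k\<^sub>1 / N\<close>. The limit of the value is
  \<open>- 2 a ln a - a + a\<^sup>2\<close>.
\<close>

section \<open>Values of the selection strategies\<close>

text \<open>
  The expected duration of an object of relative rank 2 at time \<open>k\<close> is
  \<open>\<Sum>j=k..N. k (k - 1) / (j (j - 1))\<close>, which telescopes to this product.
\<close>
definition second_duration :: "nat \<Rightarrow> nat \<Rightarrow> real" where
  "second_duration N k = real k * (real N + 1 - real k) / real N"

text \<open>
  An object of relative rank 1 at time \<open>k\<close> is still among the best two at time \<open>j\<close> with probability
  \<open>2 k / j - k (k - 1) / (j (j - 1))\<close>: twice the probability that the best of the first \<open>j\<close>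
  objects was seen by time \<open>k\<close>, minus the probability that the best two were.
\<close>
definition best_duration :: "nat \<Rightarrow> nat \<Rightarrow> real" where
  "best_duration N k = 2 * real k * (harm N - harm (k - 1)) - second_duration N k"

text \<open>
  The expected duration obtained by stopping at the first object of relative rank 1 or 2
  after time \<open>k\<close>.
\<close>
definition greedy_value :: "nat \<Rightarrow> nat \<Rightarrow> real" where
  "greedy_value N k =
     2 * real k * (harm N - harm k) - 2 * (real k - 1) * (real N - real k) / real N"

text \<open>
  The expected duration obtained by stopping at the first relatively best object after time \<open>k\<close>
  as long as the time is at most \<open>K\<close>, and at the first candidate afterwards. With
  probability \<open>k / K\<close> no relatively best object appears between \<open>k\<close> and \<open>K\<close>, and
  \<open>k / (j (j - 1))\<close> is the probability that \<open>j\<close> is the first time that one does.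
\<close>
definition best_only_value :: "nat \<Rightarrow> nat \<Rightarrow> nat \<Rightarrow> real" where
  "best_only_value N K k =
     real k * (greedy_value N K / real K +
               (\<Sum>j\<in>{k<..K}. best_duration N j / (real j * (real j - 1))))"

text \<open>
  The Bellman recursion for the optimal expected duration when the first \<open>k\<close> objects were not
  selected. The case distinction is needed because the first object cannot have
  relative rank 2. The value at \<open>N\<close> may be taken to be 0: every stopping time stops
  at \<open>N\<close> at the latest.
\<close>
function cont_value :: "nat \<Rightarrow> nat \<Rightarrow> real" where
  "cont_value N k =
     (if k \<ge> N then 0
      else (max (best_duration N (Suc k)) (cont_value N (Suc k)) +
            (if k = 0 then 0
             else max (second_duration N (Suc k)) (cont_value N (Suc k)) +
                  (real k - 1) * cont_value N (Suc k))) / real (Suc k))"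
  by pat_completeness auto
termination by (relation "Wellfounded.measure (\<lambda>(N, k). N - k)") auto

declare cont_value.simps [simp del]

lemma second_duration_last: "N \<ge> 1 \<Longrightarrow> second_duration N N = 1"
  by (simp add: second_duration_def)

lemma harm_tail_step:
  assumes "1 \<le> k"
  shows "real k * (harm N - harm k) = real k * (harm N - harm (k - 1)) - 1"
proof -
  obtain j where k: "k = Suc j" using assms by (cases k) auto
  show ?thesis unfolding k by (simp add: harm_Suc right_diff_distrib distrib_left del: of_nat_Suc)
qed

text \<open>
  A second best object lasts until the next candidate appears. A best object lives on at that
  moment, as a second best one if the newcomer is best and as the best one otherwise; as both
  cases are equally likely, its remaining expected duration is that of the newcomer, which is what
  the greedy strategy obtains.
\<close>
lemma best_duration_eq:
  assumes "1 \<le> k" "1 \<le> N"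
  shows "best_duration N k = second_duration N k + greedy_value N k"
proof -
  have "greedy_value N k = 2 * (real k * (harm N - harm (k - 1)) - 1)
          - 2 * (real k - 1) * (real N - real k) / real N"
    using harm_tail_step[OF assms(1), of N] by (simp add: greedy_value_def mult.assoc)
  then show ?thesis using assms
    by (simp add: best_duration_def second_duration_def divide_simps) (simp add: algebra_simps)
qed

lemma second_duration_step:
  assumes "1 \<le> k" "1 \<le> N"
  shows "second_duration N k =
           1 + (real k - 1) / real (Suc k) * second_duration N (Suc k)"
proof -
  have "(real k + 1) * second_duration N k = (real k + 1) + (real k - 1) * second_duration N (Suc k)"
    using assms by (simp add: second_duration_def divide_simps) (simp add: algebra_simps)
  then show ?thesis by (simp add: divide_simps) (simp add: algebra_simps)
qed

lemma greedy_value_step: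
  assumes "1 \<le> k" "1 \<le> N"
  shows "greedy_value N k =
           (best_duration N (Suc k) + second_duration N (Suc k) +
            (real k - 1) * greedy_value N (Suc k)) / real (Suc k)"
proof -
  define D where "D = harm N - (harm k :: real)"
  have g: "greedy_value N (Suc k) = 2 * ((real k + 1) * D - 1)
          - 2 * real k * (real N - real k - 1) / real N"
    using harm_tail_step[of "Suc k" N] unfolding greedy_value_def D_def mult.assoc
    by (simp add: diff_diff_add add.commute[of _ 1])
  have "greedy_value N k * real (Suc k) = best_duration N (Suc k) + second_duration N (Suc k) +
           (real k - 1) * greedy_value N (Suc k)"
    using assms unfolding g
    by (simp add: best_duration_def greedy_value_def D_def[symmetric] divide_simps)
       (simp add: algebra_simps)
  then show ?thesis by (simp add: eq_divide_eq)
qed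

lemma best_duration_step:
  assumes "1 \<le> k" "1 \<le> N"
  shows "best_duration N k =
           1 + real k / real (Suc k) * best_duration N (Suc k) +
           second_duration N (Suc k) / real (Suc k)"
proof -
  have "best_duration N k = 1 + (real k - 1) / real (Suc k) * second_duration N (Suc k)
     + (best_duration N (Suc k) + second_duration N (Suc k) +
           (real k - 1) * (best_duration N (Suc k) - second_duration N (Suc k))) / real (Suc k)"
    using best_duration_eq[OF assms] second_duration_step[OF assms] greedy_value_step[OF assms]
      best_duration_eq[of "Suc k" N] assms by simp
  also have "\<dots> = 1 + real k / real (Suc k) * best_duration N (Suc k) +
           second_duration N (Suc k) / real (Suc k)"
    by (simp add: divide_simps) (simp add: algebra_simps)
  finally show ?thesis .
qed

lemma greedy_value_last [simp]: "greedy_value N N = 0"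
  by (simp add: greedy_value_def)

lemma best_duration_last: "N \<ge> 1 \<Longrightarrow> best_duration N N = 1"
  by (simp add: best_duration_eq second_duration_last)

lemma second_duration_nonneg: "k \<le> N \<Longrightarrow> 0 \<le> second_duration N k"
  by (simp add: second_duration_def)

lemma greedy_value_nonneg:
  assumes "1 \<le> k" "k \<le> N"
  shows "0 \<le> greedy_value N k"
  using assms(2,1)
proof (induction rule: inc_induct)
  case base
  then show ?case by simp
next
  case (step k)
  have "0 \<le> greedy_value N (Suc k)" "0 \<le> second_duration N (Suc k)"
    using step second_duration_nonneg[of "Suc k" N] by auto
  moreover have "best_duration N (Suc k) = second_duration N (Suc k) + greedy_value N (Suc k)"
    using step.hyps by (intro best_duration_eq) auto
  moreover have "greedy_value N k = (best_duration N (Suc k) + second_duration N (Suc k) +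
      (real k - 1) * greedy_value N (Suc k)) / real (Suc k)"
    using step by (intro greedy_value_step) auto
  ultimately show ?case
    using step.prems by simp
qed

lemma second_le_best:
  assumes "1 \<le> k" "k \<le> N"
  shows "second_duration N k \<le> best_duration N k"
  using assms greedy_value_nonneg[OF assms] by (simp add: best_duration_eq)

lemma cont_value_last [simp]: "cont_value N N = 0"
  by (subst cont_value.simps) simp

lemma cont_value_step:
  assumes "1 \<le> k" "k < N"
  shows "cont_value N k =
     (max (best_duration N (Suc k)) (cont_value N (Suc k)) +
      max (second_duration N (Suc k)) (cont_value N (Suc k)) +
      (real k - 1) * cont_value N (Suc k)) / real (Suc k)"
  using assms by (subst cont_value.simps) simp

lemma cont_value_0: "0 < N \<Longrightarrow> cont_value N 0 = max (best_duration N 1) (cont_value N 1)"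
  by (subst cont_value.simps) simp

lemma greedy_le_cont:
  assumes "1 \<le> k" "k \<le> N"
  shows "greedy_value N k \<le> cont_value N k"
  using assms(2,1)
proof (induction rule: inc_induct)
  case base
  then show ?case by simp
next
  case (step k)
  have *: "greedy_value N k =
     (best_duration N (Suc k) + second_duration N (Suc k) +
      (real k - 1) * greedy_value N (Suc k)) / real (Suc k)"
    using step by (intro greedy_value_step) auto
  have "(real k - 1) * greedy_value N (Suc k) \<le> (real k - 1) * cont_value N (Suc k)"
    using step by (intro mult_left_mono) auto
  then show ?case unfolding * cont_value_step[OF step.prems step.hyps(2)]
    by (intro divide_right_mono add_mono) auto
qed

text \<open>
  Once second best objects are worth accepting forever, so are best ones, and the Bellman
  recursion reduces to the recursion of the greedy strategy.
\<close>
lemma cont_eq_greedy: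
  assumes "1 \<le> K" "K \<le> k" "k \<le> N"
    and acc: "\<And>j. K < j \<Longrightarrow> j \<le> N \<Longrightarrow> greedy_value N j \<le> second_duration N j"
  shows "cont_value N k = greedy_value N k"
  using assms(3,2)
proof (induction rule: inc_induct)
  case base
  then show ?case by simp
next
  case (step k)
  have "greedy_value N (Suc k) \<le> second_duration N (Suc k)"
    "second_duration N (Suc k) \<le> best_duration N (Suc k)"
    using step assms acc[of "Suc k"] second_le_best[of "Suc k" N] by auto
  moreover have "greedy_value N k = (best_duration N (Suc k) + second_duration N (Suc k) +
      (real k - 1) * greedy_value N (Suc k)) / real (Suc k)"
    using step assms(1) by (intro greedy_value_step) auto
  ultimately show ?case
    using step assms(1) by (simp add: cont_value_step max_def)
qed

lemma best_only_value_last: "1 \<le> K \<Longrightarrow> best_only_value N K K = greedy_value N K"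
  by (simp add: best_only_value_def)

lemma best_only_value_step:
  assumes "1 \<le> k" "k < K"
  shows "best_only_value N K k =
     (best_duration N (Suc k) + real k * best_only_value N K (Suc k)) / real (Suc k)"
proof -
  define T where "T = greedy_value N K / real K +
      (\<Sum>j\<in>{Suc k<..K}. best_duration N j / (real j * (real j - 1)))"
  have "{k<..K} = insert (Suc k) {Suc k<..K}" using assms by auto
  then have "best_only_value N K k =
      real k * (best_duration N (Suc k) / (real (Suc k) * real k) + T)"
    by (simp add: best_only_value_def T_def)
  also have "\<dots> = (best_duration N (Suc k) + real k * (real (Suc k) * T)) / real (Suc k)"
    using assms by (simp add: divide_simps)
  finally show ?thesis by (simp add: best_only_value_def T_def)
qed

lemma best_only_le_cont:
  assumes "1 \<le> k" "k \<le> K" "K \<le> N"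
  shows "best_only_value N K k \<le> cont_value N k"
  using assms(2,1)
proof (induction rule: inc_induct)
  case base
  then show ?case using assms by (simp add: best_only_value_last greedy_le_cont)
next
  case (step k)
  have "real k * best_only_value N K (Suc k) \<le> real k * cont_value N (Suc k)"
    using step by (intro mult_left_mono) auto
  also have "\<dots> \<le> max (second_duration N (Suc k)) (cont_value N (Suc k)) +
      (real k - 1) * cont_value N (Suc k)"
    by (simp add: algebra_simps)
  finally have "best_duration N (Suc k) + real k * best_only_value N K (Suc k) \<le>
      max (best_duration N (Suc k)) (cont_value N (Suc k)) +
      max (second_duration N (Suc k)) (cont_value N (Suc k)) +
      (real k - 1) * cont_value N (Suc k)"
    by linarith
  then show ?case using step assms
    by (simp add: best_only_value_step cont_value_step divide_right_mono)
qed

lemma cont_eq_best_only: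
  assumes "1 \<le> k" "k \<le> K" "K \<le> N"
    and last: "cont_value N K = greedy_value N K"
    and rej: "\<And>j. 2 \<le> j \<Longrightarrow> j \<le> K \<Longrightarrow> second_duration N j \<le> cont_value N j"
    and acc: "\<And>j. k < j \<Longrightarrow> j \<le> K \<Longrightarrow> best_only_value N K j \<le> best_duration N j"
  shows "cont_value N k = best_only_value N K k"
  using assms(2,1) acc
proof (induction rule: inc_induct)
  case base
  then show ?case using last by (simp add: best_only_value_last)
next
  case (step k)
  have eq: "cont_value N (Suc k) = best_only_value N K (Suc k)"
    using step by auto
  have "second_duration N (Suc k) \<le> cont_value N (Suc k)"
    using rej[of "Suc k"] step by auto
  moreover have "cont_value N (Suc k) \<le> best_duration N (Suc k)"
    using step.prems(2)[of "Suc k"] step eq by simp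
  ultimately have "cont_value N k = (best_duration N (Suc k) +
      (cont_value N (Suc k) + (real k - 1) * cont_value N (Suc k))) / real (Suc k)"
    using step assms(3) by (simp add: cont_value_step max_absorb1 max_absorb2 add.assoc)
  also have "cont_value N (Suc k) + (real k - 1) * cont_value N (Suc k) =
      real k * cont_value N (Suc k)"
    by (simp add: algebra_simps)
  finally show ?case using step eq by (simp add: best_only_value_step)
qed

lemma cont_value_const:
  assumes "k < N" and "\<And>j. 1 \<le> j \<Longrightarrow> j \<le> k \<Longrightarrow> best_duration N j \<le> cont_value N j"
  shows "cont_value N 0 = cont_value N k"
  using assms
proof (induction k)
  case 0
  then show ?case by simp
next
  case (Suc k)
  have b: "best_duration N (Suc k) \<le> cont_value N (Suc k)" using Suc.prems(2)[of "Suc k"] by simp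
  have s: "second_duration N (Suc k) \<le> cont_value N (Suc k)"
    using second_le_best[of "Suc k" N] b Suc.prems(1) by linarith
  have "cont_value N k = cont_value N (Suc k)"
  proof (cases "k = 0")
    case True
    then show ?thesis using b Suc.prems by (simp add: cont_value_0 max_def)
  next
    case False
    have "cont_value N k = (real (Suc k) * cont_value N (Suc k)) / real (Suc k)"
      using False Suc.prems b s by (subst cont_value_step) (auto simp: max_def algebra_simps)
    then show ?thesis by simp
  qed
  then show ?case using Suc by auto
qed

text \<open>
  A sequence that does not increase any more once it fails to increase stays nonnegative between
  two nonnegative values. This is what turns comparisons of values into thresholds.
\<close>
lemma unimodal_nonneg:
  fixes \<phi> :: "nat \<Rightarrow> real"
  assumes decr: "\<And>i j. m \<le> i \<Longrightarrow> i \<le> j \<Longrightarrow> j < n \<Longrightarrow> \<phi> (Suc i) \<le> \<phi> i \<Longrightarrow> \<phi> (Suc j) \<le> \<phi> j"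
    and "0 \<le> \<phi> n" "m \<le> i" "i \<le> j" "j \<le> n" "0 \<le> \<phi> i"
  shows "0 \<le> \<phi> j"
proof (rule ccontr)
  assume neg: "\<not> 0 \<le> \<phi> j"
  have "\<exists>l. i \<le> l \<and> l < j \<and> \<phi> (Suc l) \<le> \<phi> l"
  proof (rule ccontr)
    assume no: "\<not> ?thesis"
    have "\<phi> i \<le> \<phi> l" if "i \<le> l" "l \<le> j" for l
      using that
    proof (induction rule: dec_induct)
      case base
      then show ?case by simp
    next
      case (step l)
      have "\<not> \<phi> (Suc l) \<le> \<phi> l" using no step by (metis Suc_le_eq)
      with step show ?case by simp
    qed
    from this[of j] have "\<phi> i \<le> \<phi> j" using \<open>i \<le> j\<close> by simp
    with neg \<open>0 \<le> \<phi> i\<close> show False by linarith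
  qed
  then obtain l where l: "i \<le> l" "l < j" "\<phi> (Suc l) \<le> \<phi> l" by blast
  have "\<phi> n \<le> \<phi> j"
    using \<open>j \<le> n\<close>
  proof (induction rule: dec_induct)
    case base
    then show ?case by simp
  next
    case (step p)
    have "\<phi> (Suc p) \<le> \<phi> p"
      using decr[of l p] l \<open>m \<le> i\<close> step.hyps by simp
    with step.IH show ?case by linarith
  qed
  with neg \<open>0 \<le> \<phi> n\<close> show False by linarith
qed

section \<open>Threshold structure of the optimal strategy\<close>

text \<open>
  The difference \<open>second_duration - greedy_value\<close>, multiplied by \<open>N / k\<close> so that its increments
  become simple.
\<close>
definition second_surplus :: "nat \<Rightarrow> nat \<Rightarrow> real" where
  "second_surplus N k =
     3 * (real N - real k) + 3 - 2 * real N / real k - 2 * real N * (harm N - harm k)"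

text \<open>
  The division by \<open>k\<close> removes the survival probability from the recursion of
  \<open>best_only_value\<close>, so that the increments depend on \<open>best_duration\<close> alone.
\<close>
definition best_surplus :: "nat \<Rightarrow> nat \<Rightarrow> nat \<Rightarrow> real" where
  "best_surplus N K k = (best_duration N k - best_only_value N K k) / real k"

lemma second_minus_greedy:
  assumes "1 \<le> k" "1 \<le> N"
  shows "second_duration N k - greedy_value N k = real k / real N * second_surplus N k"
  using assms unfolding second_duration_def greedy_value_def second_surplus_def
  by (simp add: divide_simps) (simp add: algebra_simps)

lemma greedy_le_second_iff:
  assumes "1 \<le> k" "1 \<le> N"
  shows "greedy_value N k \<le> second_duration N k \<longleftrightarrow> 0 \<le> second_surplus N k"
proof -
  have "0 < real k / real N" using assms by simp
  then have "0 \<le> real k / real N * second_surplus N k \<longleftrightarrow> 0 \<le> second_surplus N k"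
    by (simp only: zero_le_mult_iff) auto
  then show ?thesis unfolding second_minus_greedy[OF assms, symmetric] by simp
qed

lemma second_surplus_step:
  assumes "1 \<le> k"
  shows "second_surplus N (Suc k) - second_surplus N k = 2 * real N / real k - 3"
  unfolding second_surplus_def harm_Suc using assms
  by (simp add: inverse_eq_divide right_diff_distrib distrib_left)

lemma second_surplus_nonneg_mono:
  assumes "1 \<le> i" "i \<le> j" "j \<le> N" "0 \<le> second_surplus N i"
  shows "0 \<le> second_surplus N j"
proof (rule unimodal_nonneg[where m = 1 and n = N and i = i])
  show "0 \<le> second_surplus N N"
    using assms by (simp add: second_surplus_def)
  fix i j assume ij: "1 \<le> i" "i \<le> j" "j < N" "second_surplus N (Suc i) \<le> second_surplus N i"
  have "2 * real N / real j \<le> 2 * real N / real i"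
    using ij by (intro divide_left_mono) auto
  then show "second_surplus N (Suc j) \<le> second_surplus N j"
    using ij second_surplus_step[of i N] second_surplus_step[of j N] by simp
qed (use assms in auto)

lemma best_duration_diff:
  assumes "1 \<le> k" "1 \<le> N"
  shows "best_duration N (Suc k) - best_duration N k =
           2 * (harm N - harm k) - 3 + 2 * real k / real N"
proof -
  define D where "D = harm N - (harm k :: real)"
  have "best_duration N k = 2 * (real k * D + 1) - second_duration N k"
    using harm_tail_step[OF assms(1), of N] by (simp add: best_duration_def D_def mult.assoc)
  then show ?thesis
    unfolding D_def[symmetric] using assms
    by (simp add: best_duration_def second_duration_def D_def[symmetric] divide_simps)
       (simp add: algebra_simps)
qed

text \<open>
  Expresses the concavity of \<open>best_duration\<close>: by \<open>best_duration_diff\<close> its increments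
  are a constant minus twice this sequence.
\<close>
lemma harm_minus_linear_mono:
  assumes "i \<le> j" "j \<le> N"
  shows "harm i - real i / real N \<le> harm j - real j / real N"
  using assms
proof (induction rule: dec_induct)
  case base
  then show ?case by simp
next
  case (step n)
  have "1 / real N \<le> 1 / real (Suc n)"
    using step by (intro divide_left_mono) auto
  then have "1 / real N \<le> inverse (real (Suc n))" by (simp add: inverse_eq_divide)
  moreover have "real (Suc n) / real N = real n / real N + 1 / real N"
    by (simp add: add_divide_distrib)
  ultimately show ?case using step unfolding harm_Suc by simp
qed

lemma best_surplus_step:
  assumes "1 \<le> k" "k < K"
  shows "best_surplus N K (Suc k) - best_surplus N K k =
           (best_duration N (Suc k) - best_duration N k) / real k"
proof -
  define W where "W = best_only_value N K (Suc k)"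
  show ?thesis
    unfolding best_surplus_def best_only_value_step[OF assms] W_def[symmetric]
    using assms by (simp add: divide_simps) (simp add: algebra_simps)
qed

text \<open>
  By \<open>best_surplus_step\<close> the surplus increases exactly when \<open>best_duration\<close> does, and the latter is
  concave. At \<open>K\<close> the surplus is nonnegative because there
  \<open>best_duration - greedy_value = second_duration\<close>.
\<close>
lemma best_surplus_nonneg_mono:
  assumes "1 \<le> i" "i \<le> j" "j \<le> K" "K \<le> N" "0 \<le> best_surplus N K i"
  shows "0 \<le> best_surplus N K j"
proof (rule unimodal_nonneg[where m = 1 and n = K and i = i])
  show "0 \<le> best_surplus N K K"
    using assms second_duration_nonneg[of K N]
    by (simp add: best_surplus_def best_only_value_last best_duration_eq)
  fix i j assume ij: "1 \<le> i" "i \<le> j" "j < K" "best_surplus N K (Suc i) \<le> best_surplus N K i"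
  have "best_surplus N K (Suc i) - best_surplus N K i =
          (best_duration N (Suc i) - best_duration N i) / real i"
    using ij by (intro best_surplus_step) auto
  then have "(best_duration N (Suc i) - best_duration N i) / real i \<le> 0"
    using ij by simp
  then have "best_duration N (Suc i) - best_duration N i \<le> 0"
    using ij by (simp add: divide_le_0_iff)
  moreover have "best_duration N (Suc j) - best_duration N j \<le>
                 best_duration N (Suc i) - best_duration N i"
    using harm_minus_linear_mono[of i j N] ij assms best_duration_diff[of i N]
      best_duration_diff[of j N] by simp
  ultimately have "(best_duration N (Suc j) - best_duration N j) / real j \<le> 0"
    by (intro divide_nonpos_nonneg) auto
  then show "best_surplus N K (Suc j) \<le> best_surplus N K j"
    using best_surplus_step[of j K N] ij by simp
qed (use assms in auto)

text \<open>
  The sign conditions that make \<open>k1\<close> and \<open>k2\<close> optimal thresholds. If second best objects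
  are acceptable from time 2 on, then \<open>k2 = 1\<close> whatever the surplus at time 1, where relative
  rank 2 cannot occur; hence the restriction to \<open>2 \<le> k2\<close> in the second sign condition.
\<close>
definition threshold_pair :: "nat \<Rightarrow> nat \<Rightarrow> nat \<Rightarrow> bool" where
  "threshold_pair N k1 k2 \<longleftrightarrow> 1 \<le> k2 \<and> k2 \<le> N \<and> k1 < k2 \<and>
     (\<forall>j. k2 < j \<longrightarrow> j \<le> N \<longrightarrow> 0 \<le> second_surplus N j) \<and>
     (\<forall>j. 1 \<le> j \<longrightarrow> j \<le> k2 \<longrightarrow> 2 \<le> k2 \<longrightarrow> second_surplus N j < 0) \<and>
     (\<forall>j. 1 \<le> j \<longrightarrow> k1 \<le> j \<longrightarrow> j \<le> k2 \<longrightarrow> 0 \<le> best_surplus N k2 j) \<and>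
     (\<forall>j. 1 \<le> j \<longrightarrow> j < k1 \<longrightarrow> best_surplus N k2 j < 0)"

text \<open>
  This gives the strict inequality \<open>k1 < k2\<close>: one step before the last time at which a
  second best object is rejected, a best object is already acceptable. By
  \<open>best_duration_eq\<close> and one step of the recursions the claim is
  \<open>w\<^sub>K \<le> K s\<^bsub>K-1\<^esub> + s\<^sub>K\<close>, while acceptance at \<open>K + 1\<close> bounds \<open>w\<^sub>K\<close> by
  \<open>(K + 2) / (K + 1) s\<^bsub>K+1\<^esub>\<close>; the rest is polynomial arithmetic.
\<close>
lemma best_surplus_before_threshold:
  assumes K: "2 \<le> K" "K < N" and nxt: "0 \<le> second_surplus N (Suc K)"
  shows "0 \<le> best_surplus N K (K - 1)"
proof -
  obtain l where l: "K = Suc l" "1 \<le> l" using K by (cases K) auto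
  define s0 where "s0 = second_duration N l"
  define s1 where "s1 = second_duration N K"
  define s2 where "s2 = second_duration N (Suc K)"
  define w1 where "w1 = greedy_value N K"
  define w2 where "w2 = greedy_value N (Suc K)"
  note defs = s0_def s1_def s2_def w1_def w2_def
  have w2: "w2 \<le> s2"
    using greedy_le_second_iff[of "Suc K" N] nxt K unfolding defs by simp
  have b1: "best_duration N K = s1 + w1" and b0: "best_duration N l = s0 + greedy_value N l"
    and b2: "best_duration N (Suc K) = s2 + w2"
    using K l unfolding defs by (auto intro!: best_duration_eq)
  have g0: "real K * greedy_value N l = (s1 + w1) + s1 + real (l - 1) * w1"
    using greedy_value_step[of l N] K l b1 unfolding defs by (simp add: of_nat_diff)
  have "real (Suc K) * w1 = (s2 + w2) + s2 + (real K - 1) * w2"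
    using greedy_value_step[of K N] K b2 unfolding defs by simp
  also have "\<dots> = 2 * s2 + real K * w2" by (simp add: algebra_simps)
  also have "\<dots> \<le> 2 * s2 + real K * s2"
    using w2 by (intro add_left_mono mult_left_mono) auto
  finally have w1: "real (Suc K) * w1 \<le> (real K + 2) * s2" by (simp add: algebra_simps)
  have s: "real (Suc K) * (real K * s0 + s1) \<ge> (real K + 2) * s2"
  proof -
    have "real N * (real (Suc K) * (real K * s0 + s1) - (real K + 2) * s2) =
      (real K + 1) * ((real N - real K) * (real K ^ 2 - real K - 2) + (2 * real K * (real K - 1) + real K))"
      unfolding defs second_duration_def l(1) using K l
      by (simp add: divide_simps) (simp add: algebra_simps power2_eq_square)
    also have "\<dots> \<ge> 0"
    proof -
      have "real K ^ 2 - real K - 2 = (real K - 2) * (real K + 1)"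
        by (simp add: algebra_simps power2_eq_square)
      then have "real K ^ 2 - real K - 2 \<ge> 0" using K by simp
      then show ?thesis using K by (intro mult_nonneg_nonneg add_nonneg_nonneg) auto
    qed
    finally show ?thesis using K by (simp add: zero_le_mult_iff)
  qed
  have "real (Suc K) * w1 \<le> real (Suc K) * (real K * s0 + s1)" using w1 s by linarith
  then have fin: "w1 \<le> real K * s0 + s1" by (simp del: of_nat_Suc)
  have "real K * best_only_value N K l = s1 + w1 + real l * w1"
    using best_only_value_step[of l K N] l b1 K by (simp add: best_only_value_last defs)
  moreover have "real K * best_duration N l = real K * s0 + ((s1 + w1) + s1 + real (l - 1) * w1)"
    using g0 b0 by (simp add: distrib_left)
  moreover have "real l * w1 = w1 + real (l - 1) * w1"
    using l by (simp add: of_nat_diff algebra_simps)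
  ultimately have "real K * best_only_value N K l \<le> real K * best_duration N l"
    using fin by linarith
  then have "best_only_value N K l \<le> best_duration N l"
    using K by simp
  then show ?thesis by (simp add: best_surplus_def l)
qed

text \<open>
  The threshold for rank 2 is the last time with negative surplus, and the one for rank 1 is
  the least time from which on the surplus is nonnegative. If that holds from time 1 on,
  the least such number is 0, which keeps \<open>k1 < k2\<close> also when \<open>k2 = 1\<close>.
\<close>
lemma threshold_pair_exists:
  assumes N: "1 \<le> N"
  shows "\<exists>k1 k2. threshold_pair N k1 k2"
proof -
  \<comment> \<open>The number 1 is inserted because \<open>S\<close> is empty for \<open>N \<le> 2\<close>.\<close>
  define S where "S = {j \<in> {1..N}. second_surplus N j < 0}"
  define K where "K = Max (insert 1 S)"
  have fin: "finite (insert 1 S)" by (simp add: S_def)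
  have K_in: "K \<in> insert 1 S" unfolding K_def using fin by (intro Max_in) auto
  have K_ge: "j \<le> K" if "j \<in> S" for j unfolding K_def using fin that by auto
  have K1: "1 \<le> K" unfolding K_def using fin by simp
  have KN: "K \<le> N" using K_in N by (auto simp: S_def)
  have above: "0 \<le> second_surplus N j" if "K < j" "j \<le> N" for j
    using K_ge[of j] that K1 by (force simp: S_def)
  have below: "second_surplus N j < 0" if "1 \<le> j" "j \<le> K" "2 \<le> K" for j
  proof -
    have "second_surplus N K < 0" using K_in that by (auto simp: S_def)
    then show ?thesis using second_surplus_nonneg_mono[of j K N] that KN by linarith
  qed
  have last: "0 \<le> second_surplus N N" using N by (simp add: second_surplus_def)
  let ?P = "\<lambda>k. \<forall>j. 1 \<le> j \<longrightarrow> k \<le> j \<longrightarrow> j \<le> K \<longrightarrow> 0 \<le> best_surplus N K j"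
  have PI: "?P k" if "1 \<le> k" "0 \<le> best_surplus N K k" for k
    using best_surplus_nonneg_mono[of k _ K N] that KN by blast
  have best_K: "0 \<le> best_surplus N K K"
    using K1 KN second_duration_nonneg[of K N]
    by (simp add: best_surplus_def best_only_value_last best_duration_eq)
  have PK: "?P (K - 1)"
  proof (cases "K = 1")
    case True
    then show ?thesis using best_K by (metis le_antisym)
  next
    case False
    then have "2 \<le> K" using K1 by simp
    moreover have "K \<noteq> N" using below[of K] last K1 \<open>2 \<le> K\<close> by force
    ultimately have "0 \<le> best_surplus N K (K - 1)"
      using KN above[of "Suc K"] by (intro best_surplus_before_threshold) auto
    then show ?thesis using \<open>2 \<le> K\<close> by (intro PI) auto
  qed
  define L where "L = (LEAST k. ?P k)"
  have PL: "?P L" unfolding L_def by (rule LeastI[of ?P, OF PK])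
  have "L \<le> K - 1" unfolding L_def by (rule Least_le[of ?P, OF PK])
  moreover have "best_surplus N K j < 0" if "1 \<le> j" "j < L" for j
  proof (rule ccontr)
    assume "\<not> best_surplus N K j < 0"
    then have "?P j" using that by (intro PI) auto
    then have "L \<le> j" unfolding L_def by (rule Least_le[of ?P])
    with that show False by simp
  qed
  ultimately have "threshold_pair N L K"
    unfolding threshold_pair_def using K1 KN above below PL by auto
  then show ?thesis by blast
qed

context
  fixes N k1 k2 :: nat
  assumes thr: "threshold_pair N k1 k2"
begin

lemma threshold_pair_bounds: "1 \<le> k2" "k2 \<le> N" "k1 < k2" "1 \<le> N"
  using thr by (auto simp: threshold_pair_def)

lemma greedy_le_second: "k2 < j \<Longrightarrow> j \<le> N \<Longrightarrow> greedy_value N j \<le> second_duration N j"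
  using thr threshold_pair_bounds greedy_le_second_iff[of j N]
  by (simp add: threshold_pair_def)

lemma cont_greedy: "k2 \<le> k \<Longrightarrow> k \<le> N \<Longrightarrow> cont_value N k = greedy_value N k"
  using threshold_pair_bounds greedy_le_second by (intro cont_eq_greedy[of k2]) auto

lemma cont_le_second: "k2 < j \<Longrightarrow> j \<le> N \<Longrightarrow> cont_value N j \<le> second_duration N j"
  using greedy_le_second[of j] cont_greedy[of j] by simp

lemma second_le_cont:
  assumes "2 \<le> j" "j \<le> k2"
  shows "second_duration N j \<le> cont_value N j"
proof -
  have "second_surplus N j < 0" using thr assms by (simp add: threshold_pair_def)
  then have "second_duration N j \<le> greedy_value N j"
    using greedy_le_second_iff[of j N] assms threshold_pair_bounds by simp
  also have "\<dots> \<le> cont_value N j" using assms threshold_pair_bounds by (intro greedy_le_cont) auto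
  finally show ?thesis .
qed

lemma best_only_le_best:
  assumes "1 \<le> j" "k1 \<le> j" "j \<le> k2"
  shows "best_only_value N k2 j \<le> best_duration N j"
proof -
  have "0 \<le> best_surplus N k2 j" using thr assms by (simp add: threshold_pair_def)
  then show ?thesis using assms by (simp add: best_surplus_def zero_le_divide_iff)
qed

lemma cont_best_only:
  assumes "1 \<le> k" "k1 \<le> Suc k" "k \<le> k2"
  shows "cont_value N k = best_only_value N k2 k"
  using assms threshold_pair_bounds second_le_cont best_only_le_best cont_greedy[of k2]
  by (intro cont_eq_best_only) auto

lemma cont_le_best:
  assumes "1 \<le> j" "k1 \<le> j" "j \<le> N"
  shows "cont_value N j \<le> best_duration N j"
proof (cases "j \<le> k2")
  case True
  then show ?thesis using cont_best_only[of j] best_only_le_best[of j] assms by simp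
next
  case False
  then show ?thesis using cont_le_second[of j] second_le_best[of j N] assms by simp
qed

lemma best_le_cont:
  assumes "1 \<le> j" "j < k1"
  shows "best_duration N j \<le> cont_value N j"
proof -
  have "best_surplus N k2 j < 0" using thr assms by (simp add: threshold_pair_def)
  then have "best_duration N j \<le> best_only_value N k2 j"
    using assms by (simp add: best_surplus_def divide_less_0_iff)
  also have "\<dots> \<le> cont_value N j" using assms threshold_pair_bounds by (intro best_only_le_cont) auto
  finally show ?thesis .
qed

lemma cont_value_start:
  assumes "2 \<le> k1"
  shows "cont_value N 0 = best_only_value N k2 (k1 - 1)"
proof -
  have "cont_value N 0 = cont_value N (k1 - 1)"
    using assms threshold_pair_bounds best_le_cont by (intro cont_value_const) auto
  then show ?thesis using assms threshold_pair_bounds cont_best_only[of "k1 - 1"] by simp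
qed

end

section \<open>Asymptotics\<close>

text \<open>
  The closed form of \<open>best_only_value\<close> involves \<open>\<Sum>i\<le>n. H\<^sub>i / i\<close>, which is half the sum of
  \<open>H\<^sub>n\<^sup>2\<close> and the sum below. As the latter converges, it does not contribute to the limit.
\<close>
definition harm2 :: "nat \<Rightarrow> real" where
  "harm2 n = (\<Sum>i=1..n. 1 / real i ^ 2)"

lemma ratio_imp_at_top:
  assumes "(\<lambda>N. real (k N) / real N) \<longlonglongrightarrow> x" "0 < x"
  shows "filterlim k at_top sequentially"
proof -
  have "filterlim (\<lambda>N. real (k N) / real N * real N) at_top sequentially"
    by (rule filterlim_tendsto_pos_mult_at_top[OF assms filterlim_real_sequentially])
  moreover have "\<forall>\<^sub>F N in sequentially. real (k N) / real N * real N = real (k N)"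
    using eventually_gt_at_top[of 0] by eventually_elim simp
  ultimately have "filterlim (\<lambda>N. real (k N)) at_top sequentially"
    by (simp cong: filterlim_cong)
  then show ?thesis by (simp add: filterlim_sequentially_iff_filterlim_real)
qed

lemma harm_tail_tendsto:
  assumes lim: "(\<lambda>N. real (k N) / real N) \<longlonglongrightarrow> x" and x: "0 < x"
  shows "(\<lambda>N. harm N - harm (k N)) \<longlonglongrightarrow> - ln x"
proof -
  have k: "filterlim k at_top sequentially" using ratio_imp_at_top assms .
  have "(\<lambda>N. harm (k N) - ln (real (k N))) \<longlonglongrightarrow> euler_mascheroni"
    by (rule filterlim_compose[OF euler_mascheroni_LIMSEQ k])
  then have "(\<lambda>N. (harm N - ln (real N)) - (harm (k N) - ln (real (k N)))
                - ln (real (k N) / real N)) \<longlonglongrightarrow> euler_mascheroni - euler_mascheroni - ln x"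
    using x by (intro tendsto_diff euler_mascheroni_LIMSEQ tendsto_ln lim) auto
  moreover have "\<forall>\<^sub>F N in sequentially. (harm N - ln (real N)) - (harm (k N) - ln (real (k N)))
                - ln (real (k N) / real N) = harm N - harm (k N)"
    using eventually_gt_at_top[of 0] eventually_compose_filterlim[OF eventually_gt_at_top[of 0] k]
    by eventually_elim (simp add: ln_div)
  ultimately show ?thesis by (simp cong: filterlim_cong)
qed

lemma pred_ratio_tendsto:
  assumes "(\<lambda>N. real (k N) / real N) \<longlonglongrightarrow> x" "0 < x"
  shows "(\<lambda>N. real (k N - 1) / real N) \<longlonglongrightarrow> x"
proof -
  have "(\<lambda>N. real (k N) / real N - 1 / real N) \<longlonglongrightarrow> x - 0"
    by (intro tendsto_diff assms lim_1_over_n)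
  moreover have "\<forall>\<^sub>F N in sequentially. real (k N) / real N - 1 / real N = real (k N - 1) / real N"
    using eventually_compose_filterlim[OF eventually_gt_at_top[of 0] ratio_imp_at_top[OF assms]]
    by eventually_elim (simp add: of_nat_diff diff_divide_distrib)
  ultimately show ?thesis by (simp cong: filterlim_cong)
qed

lemma inverse_tendsto_0:
  assumes "(\<lambda>N. real (k N) / real N) \<longlonglongrightarrow> x" "0 < x"
  shows "(\<lambda>N. 1 / real (k N)) \<longlonglongrightarrow> 0"
  by (rule filterlim_compose[OF lim_1_over_n ratio_imp_at_top[OF assms]])

lemma harm2_convergent: "convergent harm2"
proof -
  have "summable (\<lambda>n. 1 / real (Suc n) ^ 2)"
    using inverse_power_summable[of 2, where 'a=real] summable_Suc_iff[of "\<lambda>n. inverse (real n ^ 2)"]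
    by (simp add: inverse_eq_divide)
  then have "convergent (\<lambda>n. \<Sum>i<n. 1 / real (Suc i) ^ 2)"
    by (simp add: summable_iff_convergent)
  moreover have "(\<Sum>i<n. 1 / real (Suc i) ^ 2) = harm2 n" for n
    unfolding harm2_def by (rule sum.reindex_bij_witness[where i = "\<lambda>i. i - 1" and j = Suc]) auto
  ultimately show ?thesis by simp
qed

lemma best_sum_closed_form:
  assumes "1 \<le> k" "k \<le> K" "1 \<le> N"
  shows "(\<Sum>j\<in>{k<..K}. best_duration N j / (real j * (real j - 1))) =
     (harm (K - 1) - harm (k - 1)) * ((harm N - harm (K - 1)) + (harm N - harm (k - 1)) - 1)
     - (harm2 (K - 1) - harm2 (k - 1)) + (real K - real k) / real N"
  using assms(2)
proof (induction rule: dec_induct)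
  case base
  then show ?case by simp
next
  case (step K)
  then obtain m where K: "K = Suc m" using assms by (cases K) auto
  have ins: "{k<..Suc K} = insert (Suc K) {k<..K}" using step by auto
  have summand: "best_duration N (Suc K) / (real (Suc K) * (real (Suc K) - 1)) =
     2 * (harm N - harm K) / real K - 1 / real K + 1 / real N"
  proof -
    have "best_duration N (Suc K) = real (Suc K) * (2 * (harm N - harm K) - (real N - real K) / real N)"
      by (simp add: best_duration_def second_duration_def algebra_simps)
    then have "best_duration N (Suc K) / (real (Suc K) * (real (Suc K) - 1)) =
      (2 * (harm N - harm K) - (real N - real K) / real N) / real K"
      by simp
    then show ?thesis using K \<open>1 \<le> N\<close> by (simp add: divide_simps) (simp add: algebra_simps)
  qed
  define h x q :: real where "h = harm (K - 1)" and "x = 1 / real K" and "q = harm2 (K - 1)"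
  have hK: "harm K = h + x" and qK: "harm2 K = q + x\<^sup>2"
    unfolding h_def x_def q_def K harm2_def by (simp_all add: harm_Suc inverse_eq_divide power_divide)
  have xK: "2 * (harm N - harm K) / real K - 1 / real K = 2 * (harm N - harm K) * x - x"
    by (simp add: x_def)
  have NK: "(real (Suc K) - real k) / real N = (real K - real k) / real N + 1 / real N"
    by (simp add: diff_divide_distrib add_divide_distrib)
  have "(\<Sum>j\<in>{k<..Suc K}. best_duration N j / (real j * (real j - 1))) =
      2 * (harm N - harm K) * x - x + 1 / real N +
      (\<Sum>j\<in>{k<..K}. best_duration N j / (real j * (real j - 1)))"
    unfolding ins xK[symmetric] summand[symmetric] by simp
  then show ?case
    unfolding step.IH NK hK qK diff_Suc_1 h_def[symmetric] q_def[symmetric]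
    by (simp add: algebra_simps power2_eq_square)
qed

text \<open>
  The limit of \<open>best_only_value N K k / k\<close> as \<open>K / N\<close> tends to \<open>b\<close> and \<open>k / N\<close> tends to \<open>x\<close>.
\<close>
definition cont_limit :: "real \<Rightarrow> real \<Rightarrow> real" where
  "cont_limit b x = (ln x)\<^sup>2 - (ln b)\<^sup>2 + ln x - 3 * ln b - 2 + 3 * b - x"

lemma best_only_value_tendsto:
  assumes K: "(\<lambda>N. real (K N) / real N) \<longlonglongrightarrow> b" and b: "0 < b"
    and k: "(\<lambda>N. real (k N) / real N) \<longlonglongrightarrow> x" and x: "0 < x"
    and le: "\<forall>\<^sub>F N in sequentially. k N \<le> K N"
  shows "(\<lambda>N. best_only_value N (K N) (k N) / real (k N)) \<longlonglongrightarrow> cont_limit b x"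
proof -
  note K' = pred_ratio_tendsto[OF K b] and k' = pred_ratio_tendsto[OF k x]
  let ?hK = "\<lambda>N. harm N - harm (K N)"
  let ?hK' = "\<lambda>N. harm N - harm (K N - 1)" and ?hk' = "\<lambda>N. harm N - harm (k N - 1)"
  have h2K: "(\<lambda>N. harm2 (K N - 1)) \<longlonglongrightarrow> lim harm2"
    by (rule filterlim_compose[OF _ ratio_imp_at_top[OF K' b]])
       (use harm2_convergent in \<open>simp add: convergent_LIMSEQ_iff\<close>)
  have h2k: "(\<lambda>N. harm2 (k N - 1)) \<longlonglongrightarrow> lim harm2"
    by (rule filterlim_compose[OF _ ratio_imp_at_top[OF k' x]])
       (use harm2_convergent in \<open>simp add: convergent_LIMSEQ_iff\<close>)
  have "(\<lambda>N. 2 * ?hK N - 2 * (1 - 1 / real (K N)) * (1 - real (K N) / real N) +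
          ((?hk' N - ?hK' N) * (?hK' N + ?hk' N - 1) - (harm2 (K N - 1) - harm2 (k N - 1)) +
           (real (K N) / real N - real (k N) / real N)))
        \<longlonglongrightarrow> 2 * (- ln b) - 2 * (1 - 0) * (1 - b) +
          ((- ln x - - ln b) * (- ln b + - ln x - 1) - (lim harm2 - lim harm2) + (b - x))"
    by (intro tendsto_intros harm_tail_tendsto K k K' k' b x h2K h2k inverse_tendsto_0[OF K b])
  also have "2 * (- ln b) - 2 * (1 - 0) * (1 - b) +
          ((- ln x - - ln b) * (- ln b + - ln x - 1) - (lim harm2 - lim harm2) + (b - x))
        = cont_limit b x"
    by (simp add: cont_limit_def algebra_simps power2_eq_square)
  finally have lim: "(\<lambda>N. 2 * ?hK N - 2 * (1 - 1 / real (K N)) * (1 - real (K N) / real N) +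
          ((?hk' N - ?hK' N) * (?hK' N + ?hk' N - 1) - (harm2 (K N - 1) - harm2 (k N - 1)) +
           (real (K N) / real N - real (k N) / real N))) \<longlonglongrightarrow> cont_limit b x" .
  show ?thesis
  proof (rule Lim_transform_eventually[OF lim])
    show "\<forall>\<^sub>F N in sequentially.
        2 * ?hK N - 2 * (1 - 1 / real (K N)) * (1 - real (K N) / real N) +
          ((?hk' N - ?hK' N) * (?hK' N + ?hk' N - 1) - (harm2 (K N - 1) - harm2 (k N - 1)) +
           (real (K N) / real N - real (k N) / real N))
        = best_only_value N (K N) (k N) / real (k N)"
      using le eventually_ge_at_top[of 1]
        eventually_compose_filterlim[OF eventually_ge_at_top[of 1] ratio_imp_at_top[OF k x]]
    proof eventually_elim
      case (elim N)
      have "greedy_value N (K N) / real (K N) =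
          2 * ?hK N - 2 * (1 - 1 / real (K N)) * (1 - real (K N) / real N)"
        using elim by (simp add: greedy_value_def divide_simps)
      moreover have "(\<Sum>j\<in>{k N<..K N}. best_duration N j / (real j * (real j - 1))) =
          (?hk' N - ?hK' N) * (?hK' N + ?hk' N - 1) - (harm2 (K N - 1) - harm2 (k N - 1)) +
           (real (K N) / real N - real (k N) / real N)"
        using elim best_sum_closed_form[of "k N" "K N" N] by (simp add: diff_divide_distrib)
      moreover have "best_only_value N (K N) (k N) / real (k N) = greedy_value N (K N) / real (K N)
          + (\<Sum>j\<in>{k N<..K N}. best_duration N j / (real j * (real j - 1)))"
        using elim by (simp add: best_only_value_def)
      ultimately show ?case by simp
    qed
  qed
qed

lemma best_duration_tendsto:
  assumes k: "(\<lambda>N. real (k N) / real N) \<longlonglongrightarrow> x" and x: "0 < x"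
  shows "(\<lambda>N. best_duration N (k N) / real (k N)) \<longlonglongrightarrow> - 2 * ln x - 1 + x"
proof -
  have lim: "(\<lambda>N. 2 * (harm N - harm (k N - 1)) - (1 + 1 / real N - real (k N) / real N))
        \<longlonglongrightarrow> 2 * (- ln x) - (1 + 0 - x)"
    by (intro tendsto_intros harm_tail_tendsto pred_ratio_tendsto k x lim_1_over_n)
  have "(\<lambda>N. best_duration N (k N) / real (k N)) \<longlonglongrightarrow> 2 * (- ln x) - (1 + 0 - x)"
  proof (rule Lim_transform_eventually[OF lim])
    show "\<forall>\<^sub>F N in sequentially.
        2 * (harm N - harm (k N - 1)) - (1 + 1 / real N - real (k N) / real N) =
        best_duration N (k N) / real (k N)"
      using eventually_ge_at_top[of 1]
        eventually_compose_filterlim[OF eventually_ge_at_top[of 1] ratio_imp_at_top[OF k x]]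
      by eventually_elim
         (simp add: best_duration_def second_duration_def divide_simps, simp add: algebra_simps)
  qed
  then show ?thesis by (simp add: algebra_simps)
qed

lemma best_surplus_tendsto:
  assumes "(\<lambda>N. real (K N) / real N) \<longlonglongrightarrow> b" "0 < b"
    and "(\<lambda>N. real (k N) / real N) \<longlonglongrightarrow> x" "0 < x"
    and "\<forall>\<^sub>F N in sequentially. k N \<le> K N"
  shows "(\<lambda>N. best_surplus N (K N) (k N)) \<longlonglongrightarrow> - 2 * ln x - 1 + x - cont_limit b x"
  unfolding best_surplus_def diff_divide_distrib
  by (intro tendsto_diff best_duration_tendsto best_only_value_tendsto assms)

lemma second_surplus_tendsto:
  assumes k: "(\<lambda>N. real (k N) / real N) \<longlonglongrightarrow> x" and x: "0 < x"
  shows "(\<lambda>N. second_surplus N (k N) / real N) \<longlonglongrightarrow> 3 * (1 - x) + 2 * ln x"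
proof -
  have lim: "(\<lambda>N. 3 * (1 - real (k N) / real N) + 3 * (1 / real N) - 2 * (1 / real (k N))
              - 2 * (harm N - harm (k N)))
        \<longlonglongrightarrow> 3 * (1 - x) + 3 * 0 - 2 * 0 - 2 * (- ln x)"
    by (intro tendsto_intros harm_tail_tendsto inverse_tendsto_0[OF k x] k x lim_1_over_n)
  have "(\<lambda>N. second_surplus N (k N) / real N) \<longlonglongrightarrow> 3 * (1 - x) + 3 * 0 - 2 * 0 - 2 * (- ln x)"
  proof (rule Lim_transform_eventually[OF lim])
    show "\<forall>\<^sub>F N in sequentially. 3 * (1 - real (k N) / real N) + 3 * (1 / real N)
              - 2 * (1 / real (k N)) - 2 * (harm N - harm (k N)) = second_surplus N (k N) / real N"
      using eventually_ge_at_top[of 1]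
        eventually_compose_filterlim[OF eventually_ge_at_top[of 1] ratio_imp_at_top[OF k x]]
      by eventually_elim (simp add: second_surplus_def divide_simps; simp add: algebra_simps)
  qed
  then show ?thesis by simp
qed

lemma floor_ratio_tendsto:
  assumes "0 < x"
  shows "(\<lambda>N. real (nat \<lfloor>x * real N\<rfloor>) / real N) \<longlonglongrightarrow> x"
proof (rule tendsto_sandwich)
  show "(\<lambda>N. x - 1 / real N) \<longlonglongrightarrow> x"
    using tendsto_diff[OF tendsto_const[of x] lim_1_over_n] by simp
  show "\<forall>\<^sub>F N in sequentially. x - 1 / real N \<le> real (nat \<lfloor>x * real N\<rfloor>) / real N"
    using eventually_ge_at_top[of 1]
  proof eventually_elim
    case (elim N)
    have "x * real N - 1 \<le> real (nat \<lfloor>x * real N\<rfloor>)" by linarith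
    then have "(x * real N - 1) / real N \<le> real (nat \<lfloor>x * real N\<rfloor>) / real N"
      by (intro divide_right_mono) auto
    then show ?case using elim by (simp add: diff_divide_distrib)
  qed
  show "\<forall>\<^sub>F N in sequentially. real (nat \<lfloor>x * real N\<rfloor>) / real N \<le> x"
    using eventually_ge_at_top[of 1]
  proof eventually_elim
    case (elim N)
    have "0 \<le> x * real N" using assms by simp
    then have "real (nat \<lfloor>x * real N\<rfloor>) \<le> x * real N" by linarith
    then show ?case using elim by (simp add: divide_le_eq)
  qed
qed simp

text \<open>
  Only \<open>x\<close> up to some \<open>d > c\<close> is needed from above, because an upper bound for \<open>k N\<close> improves as
  \<open>x\<close> decreases to \<open>c\<close>. This is why monotonicity of the limiting surplus functions near
  their roots suffices below.
\<close>
lemma ratio_tendsto_squeeze: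
  fixes k :: "nat \<Rightarrow> nat"
  assumes "0 < c" "c < d"
    and below: "\<And>x. 0 < x \<Longrightarrow> x < c \<Longrightarrow> \<forall>\<^sub>F N in sequentially. nat \<lfloor>x * real N\<rfloor> \<le> k N"
    and above: "\<And>x. c < x \<Longrightarrow> x < d \<Longrightarrow> \<forall>\<^sub>F N in sequentially. k N \<le> nat \<lfloor>x * real N\<rfloor>"
  shows "(\<lambda>N. real (k N) / real N) \<longlonglongrightarrow> c"
proof (rule order_tendstoI)
  fix y assume "y < c"
  then obtain x where x: "max y 0 < x" "x < c" using dense[of "max y 0" c] \<open>0 < c\<close> by auto
  have "\<forall>\<^sub>F N in sequentially. y < real (nat \<lfloor>x * real N\<rfloor>) / real N"
    using order_tendstoD(1)[OF floor_ratio_tendsto[of x], of y] x by simp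
  moreover have "\<forall>\<^sub>F N in sequentially. nat \<lfloor>x * real N\<rfloor> \<le> k N" using below x by simp
  ultimately show "\<forall>\<^sub>F N in sequentially. y < real (k N) / real N"
  proof eventually_elim
    case (elim N)
    then have "real (nat \<lfloor>x * real N\<rfloor>) / real N \<le> real (k N) / real N"
      by (intro divide_right_mono) auto
    with elim show ?case by linarith
  qed
next
  fix y assume "c < y"
  then obtain x where x: "c < x" "x < min y d" using dense[of c "min y d"] \<open>c < d\<close> by auto
  have "\<forall>\<^sub>F N in sequentially. real (nat \<lfloor>x * real N\<rfloor>) / real N < y"
    using order_tendstoD(2)[OF floor_ratio_tendsto[of x], of y] x \<open>0 < c\<close> by simp
  moreover have "\<forall>\<^sub>F N in sequentially. k N \<le> nat \<lfloor>x * real N\<rfloor>" using above x by simp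
  ultimately show "\<forall>\<^sub>F N in sequentially. real (k N) / real N < y"
  proof eventually_elim
    case (elim N)
    then have "real (k N) / real N \<le> real (nat \<lfloor>x * real N\<rfloor>) / real N"
      by (intro divide_right_mono) auto
    with elim show ?case by linarith
  qed
qed


lemma second_margin_strict_mono:
  fixes x y :: real
  assumes "0 < x" "x < y" "y \<le> 2 / 3"
  shows "3 * (1 - x) + 2 * ln x < 3 * (1 - y) + 2 * ln y"
proof -
  have "ln (x / y) < x / y - 1"
    using assms ln_le_minus_one[of "x / y"] ln_eq_minus_one[of "x / y"] by fastforce
  then have "ln x - ln y < x / y - 1" using assms by (simp add: ln_div)
  moreover have "3 / 2 * (y - x) \<le> 1 - x / y"
  proof -
    have "3 / 2 * (y - x) * y \<le> 3 / 2 * (y - x) * (2 / 3)"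
      using assms by (intro mult_left_mono) auto
    also have "\<dots> = y - x" by simp
    finally have "3 / 2 * (y - x) \<le> (y - x) / y" using assms by (subst pos_le_divide_eq) auto
    then show ?thesis using assms by (simp add: diff_divide_distrib)
  qed
  ultimately show ?thesis by simp
qed

text \<open>
  The increment from \<open>x\<close> to \<open>y\<close> is
  \<open>(ln y - ln x) (- (ln x + ln y) - 3) + 2 (y - x)\<close>, and \<open>ln (1 / 5) < - 3 / 2\<close>.
\<close>
lemma best_margin_strict_mono:
  fixes x y :: real
  assumes "0 < x" "x < y" "y \<le> 1 / 5"
  shows "- 2 * ln x - 1 + x - cont_limit b x < - 2 * ln y - 1 + y - cont_limit b y"
proof -
  have "exp (3 / 2) \<le> (5::real)"
  proof -
    have "exp (3 / 2 :: real) ^ 2 = exp 1 ^ 3"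
      by (simp flip: exp_of_nat_mult)
    also have "\<dots> \<le> (272 / 100) ^ 3"
      using e_less_272 by (intro power_mono) auto
    also have "\<dots> \<le> 5 ^ 2" by (simp add: power2_eq_square power3_eq_cube)
    finally show ?thesis by (rule power2_le_imp_le) simp
  qed
  then have "ln (exp (3 / 2)) \<le> ln (5::real)" by (subst ln_le_cancel_iff) auto
  then have "3 / 2 \<le> ln (5::real)" by simp
  moreover have "ln y \<le> ln (1 / 5)" "ln x < ln y" using assms by simp_all
  ultimately have "0 \<le> (ln y - ln x) * (- (ln x + ln y) - 3)"
    by (intro mult_nonneg_nonneg) (auto simp: ln_div)
  then show ?thesis using assms
    by (simp add: cont_limit_def power2_eq_square algebra_simps)
qed

lemma second_threshold_tendsto:
  assumes thr: "\<And>N. 1 \<le> N \<Longrightarrow> threshold_pair N (k1 N) (k2 N)"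
    and b: "0 < b" "b < 2 / 3" "3 * (1 - b) + 2 * ln b = 0"
  shows "(\<lambda>N. real (k2 N) / real N) \<longlonglongrightarrow> b"
proof (rule ratio_tendsto_squeeze[where d = "2 / 3"])
  fix x assume x: "0 < x" "x < b"
  let ?k = "\<lambda>N. nat \<lfloor>x * real N\<rfloor>"
  have "3 * (1 - x) + 2 * ln x < 0"
    using second_margin_strict_mono[of x b] x b by simp
  then have "\<forall>\<^sub>F N in sequentially. second_surplus N (?k N) / real N < 0"
    using second_surplus_tendsto[OF floor_ratio_tendsto] x by (intro order_tendstoD(2)) auto
  moreover have "\<forall>\<^sub>F N in sequentially. real (?k N) / real N < 1"
    using order_tendstoD(2)[OF floor_ratio_tendsto[of x], of 1] x b by simp
  ultimately show "\<forall>\<^sub>F N in sequentially. ?k N \<le> k2 N"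
    using eventually_ge_at_top[of 1]
  proof eventually_elim
    case (elim N)
    have "?k N \<le> N" using elim by (simp add: divide_less_eq)
    show ?case
    proof (rule ccontr)
      assume "\<not> ?k N \<le> k2 N"
      then have "0 \<le> second_surplus N (?k N)"
        using elim \<open>?k N \<le> N\<close> thr[of N] unfolding threshold_pair_def by (simp add: not_le)
      then show False using elim by (simp add: divide_less_0_iff)
    qed
  qed
next
  fix x assume x: "b < x" "x < 2 / 3"
  let ?k = "\<lambda>N. nat \<lfloor>x * real N\<rfloor>"
  have "0 < x" using x b by simp
  have "3 * (1 - x) + 2 * ln x > 0"
    using second_margin_strict_mono[of b x] x b by simp
  then have "\<forall>\<^sub>F N in sequentially. second_surplus N (?k N) / real N > 0"
    using second_surplus_tendsto[OF floor_ratio_tendsto] \<open>0 < x\<close> by (intro order_tendstoD(1)) auto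
  then show "\<forall>\<^sub>F N in sequentially. k2 N \<le> ?k N"
    using eventually_ge_at_top[of 1]
      eventually_compose_filterlim[OF eventually_ge_at_top[of 2]
        ratio_imp_at_top[OF floor_ratio_tendsto[OF \<open>0 < x\<close>] \<open>0 < x\<close>]]
  proof eventually_elim
    case (elim N)
    show ?case
    proof (rule ccontr)
      assume "\<not> k2 N \<le> ?k N"
      then have "second_surplus N (?k N) < 0"
        using elim thr[of N] unfolding threshold_pair_def by auto
      then show False using elim by (simp add: zero_less_divide_iff)
    qed
  qed
qed (use b in auto)

lemma best_threshold_tendsto:
  assumes thr: "\<And>N. 1 \<le> N \<Longrightarrow> threshold_pair N (k1 N) (k2 N)"
    and k2: "(\<lambda>N. real (k2 N) / real N) \<longlonglongrightarrow> b"
    and a: "0 < a" "a < 1 / 5" "1 / 5 < b" "- 2 * ln a - 1 + a = cont_limit b a"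
  shows "(\<lambda>N. real (k1 N) / real N) \<longlonglongrightarrow> a"
proof -
  let ?k = "\<lambda>x N. nat \<lfloor>x * real N\<rfloor>"
  have le: "\<forall>\<^sub>F N in sequentially. ?k x N \<le> k2 N" if "0 < x" "x < 1 / 5" for x
  proof -
    have "\<forall>\<^sub>F N in sequentially. real (?k x N) / real N < 1 / 5"
      using order_tendstoD(2)[OF floor_ratio_tendsto[of x], of "1 / 5"] that by simp
    moreover have "\<forall>\<^sub>F N in sequentially. 1 / 5 < real (k2 N) / real N"
      using order_tendstoD(1)[OF k2, of "1 / 5"] a by simp
    ultimately show ?thesis
      using eventually_ge_at_top[of 1]
    proof eventually_elim
      case (elim N)
      then have "real (?k x N) / real N < real (k2 N) / real N" by linarith
      then show ?case using elim by (simp add: divide_less_cancel)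
    qed
  qed
  have lim: "(\<lambda>N. best_surplus N (k2 N) (?k x N)) \<longlonglongrightarrow> - 2 * ln x - 1 + x - cont_limit b x"
    if "0 < x" "x < 1 / 5" for x
    using that a by (intro best_surplus_tendsto floor_ratio_tendsto k2 le) auto
  have ge1: "\<forall>\<^sub>F N in sequentially. 1 \<le> ?k x N" if "0 < x" for x
    by (rule eventually_compose_filterlim[OF eventually_ge_at_top[of 1]
          ratio_imp_at_top[OF floor_ratio_tendsto[OF that] that]])
  show ?thesis
  proof (rule ratio_tendsto_squeeze[where d = "1 / 5"])
    fix x assume x: "0 < x" "x < a"
    have "- 2 * ln x - 1 + x - cont_limit b x < 0"
      using best_margin_strict_mono[of x a b] x a by simp
    then have "\<forall>\<^sub>F N in sequentially. best_surplus N (k2 N) (?k x N) < 0"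
      using order_tendstoD(2)[OF lim[of x], of 0] x a by simp
    moreover have "\<forall>\<^sub>F N in sequentially. ?k x N \<le> k2 N" using le x a by simp
    ultimately show "\<forall>\<^sub>F N in sequentially. ?k x N \<le> k1 N"
      using ge1[OF x(1)] eventually_ge_at_top[of 1]
    proof eventually_elim
      case (elim N)
      show ?case
      proof (rule ccontr)
        assume "\<not> ?k x N \<le> k1 N"
        then have "0 \<le> best_surplus N (k2 N) (?k x N)"
          using elim thr[of N] unfolding threshold_pair_def by (simp add: not_le)
        then show False using elim by simp
      qed
    qed
  next
    fix x assume x: "a < x" "x < 1 / 5"
    have "0 < x" using x a by simp
    have "- 2 * ln x - 1 + x - cont_limit b x > 0"
      using best_margin_strict_mono[of a x b] x a by simp
    then have "\<forall>\<^sub>F N in sequentially. best_surplus N (k2 N) (?k x N) > 0"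
      using order_tendstoD(1)[OF lim[of x], of 0] x a by simp
    then show "\<forall>\<^sub>F N in sequentially. k1 N \<le> ?k x N"
      using ge1[OF \<open>0 < x\<close>] eventually_ge_at_top[of 1]
    proof eventually_elim
      case (elim N)
      show ?case
      proof (rule ccontr)
        assume "\<not> k1 N \<le> ?k x N"
        then have "best_surplus N (k2 N) (?k x N) < 0"
          using elim thr[of N] unfolding threshold_pair_def by (simp add: not_le)
        then show False using elim by simp
      qed
    qed
  qed (use a in auto)
qed

lemma cont_value_tendsto:
  assumes thr: "\<And>N. 1 \<le> N \<Longrightarrow> threshold_pair N (k1 N) (k2 N)"
    and k2: "(\<lambda>N. real (k2 N) / real N) \<longlonglongrightarrow> b" "0 < b"
    and k1: "(\<lambda>N. real (k1 N) / real N) \<longlonglongrightarrow> a" "0 < a"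
  shows "(\<lambda>N. cont_value N 0 / real N) \<longlonglongrightarrow> a * cont_limit b a"
proof -
  let ?k = "\<lambda>N. k1 N - 1"
  note k' = pred_ratio_tendsto[OF k1]
  have le: "\<forall>\<^sub>F N in sequentially. ?k N \<le> k2 N"
    using eventually_ge_at_top[of 1]
    by eventually_elim (use thr in \<open>force simp: threshold_pair_def\<close>)
  have lim: "(\<lambda>N. real (?k N) / real N * (best_only_value N (k2 N) (?k N) / real (?k N)))
          \<longlonglongrightarrow> a * cont_limit b a"
    by (intro tendsto_mult k' best_only_value_tendsto k2 k1(2) le)
  show ?thesis
  proof (rule Lim_transform_eventually[OF lim])
    show "\<forall>\<^sub>F N in sequentially. real (?k N) / real N *
        (best_only_value N (k2 N) (?k N) / real (?k N)) = cont_value N 0 / real N"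
      using eventually_ge_at_top[of 1]
        eventually_compose_filterlim[OF eventually_ge_at_top[of 2] ratio_imp_at_top[OF k1]]
    proof eventually_elim
      case (elim N)
      then show ?case using cont_value_start[OF thr[of N]] by simp
    qed
  qed
qed

section \<open>Numerical values of the limits\<close>

lemma ln_2_bounds: "ln (2::real) \<in> {0.69314718055 .. 0.69314718057}"
  using ln_approx_bounds[of 2 12] by (simp add: eval_nat_numeral)

text \<open>
  The series for \<open>ln z\<close> converges fast, and with small fractions, when \<open>z\<close> is
  close to 1. The argument is therefore moved next to 1 by multiplying with \<open>8 \<cdot> 27 / 26\<close>
  (and with \<open>2 \<cdot> 6 / 5\<close> below), whose logarithms are bounded separately.
\<close>
lemma ln_a_bounds:
  "ln (0.12038130 :: real) \<in> {-2.1170910740 .. -2.1170910735}"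
  "ln (0.12038131 :: real) \<in> {-2.1170909910 .. -2.1170909905}"
proof -
  have r: "ln (27 / 26 :: real) \<in> {0.03774032797 .. 0.03774032799}"
    using ln_approx_bounds[of "27 / 26" 3] by (simp add: eval_nat_numeral)
  have split: "ln x = ln (x * 8 * (27 / 26)) - 3 * ln 2 - ln (27 / 26)" if "0 < x" for x :: real
  proof -
    have "ln (8::real) = 3 * ln 2" using ln_realpow[of "2::real" 3] by simp
    then show ?thesis using that ln_mult[of "x * 8" "27 / 26"] ln_mult[of x 8] by simp
  qed
  have "ln (0.12038130 * 8 * (27 / 26) :: real) \<in> {0.00009079587 .. 0.00009079588}"
    using ln_approx_bounds[of "0.12038130 * 8 * (27 / 26)" 1] by (simp add: eval_nat_numeral)
  then show "ln (0.12038130 :: real) \<in> {-2.1170910740 .. -2.1170910735}"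
    using ln_2_bounds r split[of "0.12038130"] by simp
  have "ln (0.12038131 * 8 * (27 / 26) :: real) \<in> {0.00009087894 .. 0.00009087895}"
    using ln_approx_bounds[of "0.12038131 * 8 * (27 / 26)" 1] by (simp add: eval_nat_numeral)
  then show "ln (0.12038131 :: real) \<in> {-2.1170909910 .. -2.1170909905}"
    using ln_2_bounds r split[of "0.12038131"] by simp
qed

lemma ln_b_bounds:
  "ln (0.41718835 :: real) \<in> {-0.8742174810 .. -0.8742174800}"
  "ln (0.41718836 :: real) \<in> {-0.8742174570 .. -0.8742174560}"
proof -
  have r: "ln (6 / 5 :: real) \<in> {0.18232155672 .. 0.18232155694}"
    using ln_approx_bounds[of "6 / 5" 5] by (simp add: eval_nat_numeral)
  have split: "ln x = ln (x * 2 * (6 / 5)) - ln 2 - ln (6 / 5)" if "0 < x" for x :: real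
    using that ln_mult[of "x * 2" "6 / 5"] ln_mult[of x 2] by simp
  have "ln (0.41718835 * 2 * (6 / 5) :: real) \<in> {0.00125125668 .. 0.00125125705}"
    using ln_approx_bounds[of "0.41718835 * 2 * (6 / 5)" 1] by (simp add: eval_nat_numeral)
  then show "ln (0.41718835 :: real) \<in> {-0.8742174810 .. -0.8742174800}"
    using ln_2_bounds r split[of "0.41718835"] by simp
  have "ln (0.41718836 * 2 * (6 / 5) :: real) \<in> {0.00125128065 .. 0.00125128102}"
    using ln_approx_bounds[of "0.41718836 * 2 * (6 / 5)" 1] by (simp add: eval_nat_numeral)
  then show "ln (0.41718836 :: real) \<in> {-0.8742174570 .. -0.8742174560}"
    using ln_2_bounds r split[of "0.41718836"] by simp
qed

lemma rounds_to_six_decimalsI: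
  assumes "\<bar>10 ^ 6 * x - real_of_int n\<bar> < 1 / 2" "y = real_of_int n / 10 ^ 6"
  shows "x \<cong>\<^sub>6 y"
  using round_unique'[OF assms(1)] assms(2) by (simp add: rounds_to_six_decimals_def)

text \<open>
  The intervals are this narrow because \<open>b\<close> is less than \<open>1.5 \<cdot> 10\<^sup>-\<^sup>7\<close> away from a point where the
  sixth decimal changes, and because the limiting value, a function of \<open>a\<close>, has to be enclosed
  to \<open>2 \<cdot> 10\<^sup>-\<^sup>7\<close>. As \<open>ln b = 3 (b - 1) / 2\<close>, the logarithm of \<open>b\<close> is known as precisely as \<open>b\<close>.
\<close>
lemma limit_constants_exist:
  obtains a b :: real where
    "0.12038130 \<le> a" "a \<le> 0.12038131" "- 2 * ln a - 1 + a = cont_limit b a"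
    "0.41718835 \<le> b" "b \<le> 0.41718836" "3 * (1 - b) + 2 * ln b = 0"
proof -
  define F where "F = (\<lambda>x::real. 3 * (1 - x) + 2 * ln x)"
  have "\<exists>b\<ge>0.41718835. b \<le> 0.41718836 \<and> F b = 0"
  proof (rule IVT')
    show "F 0.41718835 \<le> 0" "0 \<le> F 0.41718836" using ln_b_bounds by (auto simp: F_def)
    show "continuous_on {0.41718835..0.41718836} F"
      unfolding F_def by (intro continuous_intros) auto
  qed simp
  then obtain b :: real where b: "0.41718835 \<le> b" "b \<le> 0.41718836" "3 * (1 - b) + 2 * ln b = 0"
    by (auto simp: F_def)
  define L where "L = ln b"
  have L: "- 0.874217475 \<le> L" "L \<le> - 0.87421746" "3 * b = 2 * L + 3"
    using b by (auto simp: L_def)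
  define H where "H = (\<lambda>x. - 2 * ln x - 1 + x - cont_limit b x)"
  have H: "H x = L\<^sup>2 + L - (ln x)\<^sup>2 - 3 * ln x + 2 * x - 2" for x
    using L(3) by (simp add: H_def cont_limit_def L_def)
  have "(- L) ^ 2 \<le> 0.874217475 ^ 2" "0.87421746 ^ 2 \<le> (- L) ^ 2"
    using L by (intro power_mono; simp)+
  then have c: "L\<^sup>2 + L \<le> 0.874217475 ^ 2 - 0.874217475 + 0.000000015"
               "L\<^sup>2 + L \<ge> 0.87421746 ^ 2 - 0.87421746 - 0.000000015"
    using L by simp_all
  have "\<exists>a\<ge>0.12038130. a \<le> 0.12038131 \<and> H a = 0"
  proof (rule IVT')
    have "H 0.12038130 \<le> 0"
    proof -
      have "(- ln (0.12038130 :: real)) ^ 2 \<ge> 2.1170910735 ^ 2"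
        using ln_a_bounds(1) by (intro power_mono) simp_all
      then show ?thesis using ln_a_bounds(1) c unfolding H by (simp add: power_divide)
    qed
    then show "H 0.12038130 \<le> 0" .
    have "0 \<le> H 0.12038131"
    proof -
      have "(- ln (0.12038131 :: real)) ^ 2 \<le> 2.1170909910 ^ 2"
        using ln_a_bounds(2) by (intro power_mono) simp_all
      then show ?thesis using ln_a_bounds(2) c unfolding H by (simp add: power_divide)
    qed
    then show "0 \<le> H 0.12038131" .
    have "continuous_on {0.12038130..0.12038131} (\<lambda>x. L\<^sup>2 + L - (ln x)\<^sup>2 - 3 * ln x + 2 * x - 2)"
      by (intro continuous_intros) auto
    then show "continuous_on {0.12038130..0.12038131} H" by (simp add: H[abs_def])
  qed simp
  then obtain a where a: "0.12038130 \<le> a" "a \<le> 0.12038131" "- 2 * ln a - 1 + a = cont_limit b a"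
    by (auto simp: H_def)
  show ?thesis using that[OF a b] .
qed

section \<open>Relative ranks of a random permutation\<close>

definition rank_code :: "nat \<Rightarrow> (nat \<Rightarrow> nat) \<Rightarrow> nat \<Rightarrow> nat" where
  "rank_code N p = restrict (\<lambda>k. card {i \<in> {1..k}. p i \<le> p k}) {1..N}"

definition rank_codes :: "nat \<Rightarrow> (nat \<Rightarrow> nat) set" where
  "rank_codes N = PiE {1..N} (\<lambda>k. {1..k})"

lemma le_set_eq_insert:
  fixes p :: "'b \<Rightarrow> nat"
  assumes "inj_on p A" "k \<in> A"
  shows "{i \<in> A. p i \<le> p k} = insert k {i \<in> A. p i < p k}"
proof -
  have "p i \<le> p k \<longleftrightarrow> i = k \<or> p i < p k" if "i \<in> A" for i
    using inj_onD[OF assms(1), of i k] that assms(2) by (cases "p i = p k") auto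
  then show ?thesis using assms(2) by auto
qed

lemma rank_code_in: "rank_code N p \<in> rank_codes N"
proof -
  have "1 \<le> card {i \<in> {1..k}. p i \<le> p k}" "card {i \<in> {1..k}. p i \<le> p k} \<le> k" if "1 \<le> k" for k
  proof -
    have "card {k} \<le> card {i \<in> {1..k}. p i \<le> p k}" using that by (intro card_mono) auto
    then show "1 \<le> card {i \<in> {1..k}. p i \<le> p k}" by simp
    have "card {i \<in> {1..k}. p i \<le> p k} \<le> card {1..k}" by (intro card_mono) auto
    then show "card {i \<in> {1..k}. p i \<le> p k} \<le> k" by simp
  qed
  then show ?thesis by (auto simp: rank_code_def rank_codes_def)
qed

text \<open>
  The relative ranks determine the order of the objects: the objects before \<open>k\<close> with a smaller
  value form an initial segment of the earlier order, and the relative rank of \<open>k\<close> is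
  the size of that segment plus 1.
\<close>
lemma same_code_same_order:
  assumes inj: "inj_on p {1..N}" "inj_on q {1..N}" and eq: "rank_code N p = rank_code N q"
    and "n \<le> N" "i \<in> {1..n}" "j \<in> {1..n}"
  shows "p i \<le> p j \<longleftrightarrow> q i \<le> q j"
  using assms(4-6)
proof (induction n arbitrary: i j)
  case 0
  then show ?case by simp
next
  case (Suc n)
  define k where "k = Suc n"
  have k: "1 \<le> k" "k \<le> N" using Suc.prems by (auto simp: k_def)
  have k_in: "k \<in> {1..k}" using k by simp
  have injk: "inj_on p {1..k}" "inj_on q {1..k}"
    using inj k by (auto elim!: inj_on_subset)
  let ?A = "{i \<in> {1..n}. p i < p k}" and ?B = "{i \<in> {1..n}. q i < q k}"
  have cards: "card {i \<in> {1..k}. p i \<le> p k} = card {i \<in> {1..k}. q i \<le> q k}"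
    using fun_cong[OF eq, of k] k by (simp add: rank_code_def)
  have A: "{i \<in> {1..k}. p i < p k} = ?A" and B: "{i \<in> {1..k}. q i < q k} = ?B"
    by (auto simp: k_def le_Suc_eq)
  have card_eq: "card ?A = card ?B"
    using cards unfolding le_set_eq_insert[OF injk(1) k_in] le_set_eq_insert[OF injk(2) k_in] A B
    by (simp add: k_def)
  have "?A \<subseteq> ?B \<or> ?B \<subseteq> ?A"
  proof (rule ccontr)
    assume "\<not> ?thesis"
    then obtain i j where "i \<in> ?A" "i \<notin> ?B" "j \<in> ?B" "j \<notin> ?A" by blast
    then show False using Suc.IH[of i j] Suc.prems(1) by auto
  qed
  then have AB: "?A = ?B"
    using card_eq card_subset_eq[of ?A ?B] card_subset_eq[of ?B ?A] by auto
  have less: "p i < p k \<longleftrightarrow> q i < q k" if "i \<in> {1..n}" for i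
    using AB that by blast
  have neq: "p i \<noteq> p k" "q i \<noteq> q k" if "i \<in> {1..n}" for i
    using inj_onD[OF injk(1), of i k] inj_onD[OF injk(2), of i k] that k by (auto simp: k_def)
  consider "i \<in> {1..n}" "j \<in> {1..n}" | "i \<in> {1..n}" "j = k" | "i = k" "j \<in> {1..n}" | "i = k" "j = k"
    using Suc.prems by (fastforce simp: k_def)
  then show ?case
  proof cases
    case 1
    then show ?thesis using Suc by simp
  next
    case 2
    then show ?thesis using less[of i] neq[of i] by auto
  next
    case 3
    then show ?thesis using less[of j] neq[of j] by auto
  qed simp
qed

lemma value_eq_count_le:
  assumes "bij_betw p {1..N} {1..N}" "i \<in> {1..N}"
  shows "p i = card {j \<in> {1..N}. p j \<le> p i}"
proof -
  have "p i \<in> {1..N}" using assms by (auto simp: bij_betw_def)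
  have "p ` {j \<in> {1..N}. p j \<le> p i} = {v \<in> p ` {1..N}. v \<le> p i}" by blast
  also have "\<dots> = {1..p i}"
    using \<open>p i \<in> {1..N}\<close> assms(1) by (auto simp: bij_betw_def)
  finally have "p ` {j \<in> {1..N}. p j \<le> p i} = {1..p i}" .
  moreover have "inj_on p {j \<in> {1..N}. p j \<le> p i}"
    using assms by (auto simp: bij_betw_def elim!: inj_on_subset)
  ultimately show ?thesis by (metis card_atLeastAtMost card_image diff_Suc_1)
qed

lemma rank_code_inj:
  assumes "bij_betw p {1..N} {1..N}" "bij_betw q {1..N} {1..N}"
    and "rank_code N p = rank_code N q" "i \<in> {1..N}"
  shows "p i = q i"
proof -
  have "{j \<in> {1..N}. p j \<le> p i} = {j \<in> {1..N}. q j \<le> q i}"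
    using same_code_same_order[of p N q N _ i] assms by (auto simp: bij_betw_def)
  then show ?thesis
    using value_eq_count_le[OF assms(1,4)] value_eq_count_le[OF assms(2,4)] by simp
qed

text \<open>
  This is the Lehmer code: an injection between sets of the same size \<open>N!\<close>. It carries
  the uniform distribution on permutations to the uniform distribution on the product of the
  sets \<open>{1..k}\<close>, hence makes the relative ranks independent and uniform.
\<close>
lemma rank_code_bij: "bij_betw (rank_code N) {p. p permutes {1..N}} (rank_codes N)"
proof -
  have inj: "inj_on (rank_code N) {p. p permutes {1..N}}"
  proof (rule inj_onI, rule ext)
    fix p q i
    assume pq: "p \<in> {p. p permutes {1..N}}" "q \<in> {p. p permutes {1..N}}"
      "rank_code N p = rank_code N q"
    show "p i = q i"
    proof (cases "i \<in> {1..N}")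
      case True
      then show ?thesis using pq rank_code_inj[of p N q i] by (auto dest: permutes_imp_bij)
    next
      case False
      then show ?thesis using pq by (auto simp: permutes_def)
    qed
  qed
  have "card {p. p permutes {1..N}} = fact N" by (rule card_permutations) auto
  moreover have "card (rank_codes N) = fact N"
    by (simp add: rank_codes_def card_PiE fact_prod)
  moreover have "finite (rank_codes N)" by (simp add: rank_codes_def finite_PiE)
  moreover have "rank_code N ` {p. p permutes {1..N}} \<subseteq> rank_codes N"
    using rank_code_in by blast
  ultimately have "rank_code N ` {p. p permutes {1..N}} = rank_codes N"
    using inj by (metis card_image card_subset_eq)
  then show ?thesis using inj by (simp add: bij_betw_def)
qed

locale uniform_ranking = prob_space M for M :: "'a measure" +
  fixes N :: nat and X :: "nat \<Rightarrow> 'a \<Rightarrow> nat"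
  assumes N_pos: "1 \<le> N" and unif: "uniform_random_permutation M N X"
begin

abbreviation code :: "'a \<Rightarrow> nat \<Rightarrow> nat" where
  "code \<omega> \<equiv> rank_code N (\<lambda>k. X k \<omega>)"

abbreviation Y :: "nat \<Rightarrow> 'a \<Rightarrow> nat" where
  "Y \<equiv> relative_rank X"

lemma X_bij: "\<omega> \<in> space M \<Longrightarrow> bij_betw (\<lambda>k. X k \<omega>) {1..N} {1..N}"
  using unif unfolding uniform_random_permutation_def by blast

lemma code_eq: "k \<in> {1..N} \<Longrightarrow> code \<omega> k = Y k \<omega>"
  by (simp add: rank_code_def relative_rank_def)

lemma code_cong: "(\<And>k. k \<in> {1..N} \<Longrightarrow> X k \<omega> = p k) \<Longrightarrow> code \<omega> = rank_code N p"
  unfolding rank_code_def by (intro restrict_ext arg_cong[where f = card] Collect_cong) auto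

lemma prob_code_eq:
  assumes "y \<in> rank_codes N"
  shows "prob {\<omega> \<in> space M. code \<omega> = y} = 1 / fact N"
proof -
  have "y \<in> rank_code N ` {p. p permutes {1..N}}"
    unfolding bij_betw_imp_surj_on[OF rank_code_bij] by (rule assms)
  then obtain p where p: "p permutes {1..N}" "rank_code N p = y" by blast
  have "{\<omega> \<in> space M. code \<omega> = y} = {\<omega> \<in> space M. \<forall>k\<in>{1..N}. X k \<omega> = p k}"
  proof (intro Collect_cong conj_cong refl iffI ballI)
    fix \<omega> k assume "\<omega> \<in> space M" "code \<omega> = y" "k \<in> {1..N}"
    then show "X k \<omega> = p k"
      using rank_code_inj[OF X_bij permutes_imp_bij[OF p(1)]] p(2) by metis
  next
    fix \<omega> assume "\<forall>k\<in>{1..N}. X k \<omega> = p k"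
    then show "code \<omega> = y" using code_cong[of \<omega> p] p(2) by simp
  qed
  then show ?thesis using unif p by (simp add: uniform_random_permutation_def)
qed

lemma code_set_events:
  assumes "B \<subseteq> rank_codes N"
  shows "{\<omega> \<in> space M. code \<omega> \<in> B} \<in> events"
    and "prob {\<omega> \<in> space M. code \<omega> \<in> B} = real (card B) / fact N"
proof -
  have fin: "finite B" using assms by (rule finite_subset) (simp add: rank_codes_def finite_PiE)
  have single: "{\<omega> \<in> space M. code \<omega> = y} \<in> events" if "y \<in> B" for y
    using prob_code_eq[of y] assms that measure_notin_sets[of "{\<omega> \<in> space M. code \<omega> = y}" M] by force
  have eq: "{\<omega> \<in> space M. code \<omega> \<in> B} = (\<Union>y\<in>B. {\<omega> \<in> space M. code \<omega> = y})" by auto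
  show "{\<omega> \<in> space M. code \<omega> \<in> B} \<in> events"
    unfolding eq using fin single by auto
  have "prob (\<Union>y\<in>B. {\<omega> \<in> space M. code \<omega> = y}) = (\<Sum>y\<in>B. prob {\<omega> \<in> space M. code \<omega> = y})"
    using fin single by (intro finite_measure_finite_Union) (auto simp: disjoint_family_on_def)
  also have "\<dots> = (\<Sum>y\<in>B. 1 / fact N)"
    using assms by (intro sum.cong refl prob_code_eq) auto
  finally show "prob {\<omega> \<in> space M. code \<omega> \<in> B} = real (card B) / fact N"
    unfolding eq by simp
qed

text \<open>
  The events determined by the first \<open>k\<close> relative ranks. On the finitely many values of the code
  this pointwise condition is easier to verify than membership in the generated \<open>\<sigma>\<close>-algebra,
  and \<open>filtration_determined\<close> shows that it is implied by the latter.
\<close>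
definition determined :: "nat \<Rightarrow> 'a set \<Rightarrow> bool" where
  "determined k A \<longleftrightarrow> A \<subseteq> space M \<and>
     (\<forall>\<omega>\<in>space M. \<forall>\<omega>'\<in>space M. (\<forall>i\<in>{1..k}. Y i \<omega> = Y i \<omega>') \<longrightarrow> (\<omega> \<in> A \<longleftrightarrow> \<omega>' \<in> A))"

lemma determined_Int: "determined k A \<Longrightarrow> determined k B \<Longrightarrow> determined k (A \<inter> B)"
  unfolding determined_def by blast

lemma determined_Diff: "determined k A \<Longrightarrow> determined k B \<Longrightarrow> determined k (A - B)"
  unfolding determined_def by blast

lemma determined_space: "determined k (space M)"
  unfolding determined_def by blast

lemma determined_UN:
  assumes "\<And>i. determined k (a i)"
  shows "determined k (\<Union>i. a i)"
  unfolding determined_def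
proof (intro conjI ballI impI)
  show "(\<Union>i. a i) \<subseteq> space M"
    using assms unfolding determined_def by (intro UN_least) (rule conjunct1)
  fix \<omega> \<omega>'
  assume \<omega>: "\<omega> \<in> space M" "\<omega>' \<in> space M" "\<forall>i\<in>{1..k}. Y i \<omega> = Y i \<omega>'"
  have "\<omega> \<in> a i \<longleftrightarrow> \<omega>' \<in> a i" for i
    using assms[of i] \<omega> unfolding determined_def by blast
  then show "\<omega> \<in> (\<Union>i. a i) \<longleftrightarrow> \<omega>' \<in> (\<Union>i. a i)" by simp
qed

lemma determined_mono: "determined k A \<Longrightarrow> k \<le> l \<Longrightarrow> determined l A"
  unfolding determined_def by (meson atLeastAtMost_iff le_trans)

lemma determined_eq_code:
  assumes "determined k A" "k \<le> N"
  shows "A = {\<omega> \<in> space M. code \<omega> \<in> code ` A}"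
proof -
  have "\<omega> \<in> A" if "\<omega> \<in> space M" "\<omega>' \<in> A" "code \<omega> = code \<omega>'" for \<omega> \<omega>'
  proof -
    have "Y i \<omega> = Y i \<omega>'" if "i \<in> {1..k}" for i
      using fun_cong[OF \<open>code \<omega> = code \<omega>'\<close>, of i] code_eq[of i] that \<open>k \<le> N\<close> by simp
    then show ?thesis using assms that unfolding determined_def by blast
  qed
  moreover have "A \<subseteq> space M" using assms(1) by (simp add: determined_def)
  ultimately show ?thesis by blast
qed

lemma determined_events:
  assumes "determined k A" "k \<le> N"
  shows "A \<in> events"
proof -
  have "code ` A \<subseteq> rank_codes N" using rank_code_in by blast
  from code_set_events(1)[OF this] show ?thesis
    unfolding determined_eq_code[OF assms, symmetric] .
qed

lemma filtration_determined:
  assumes "A \<in> sets (rank_filtration M X k)"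
  shows "determined k A"
proof -
  let ?G = "{Y i -` A \<inter> space M | i A. i \<in> {1..k}}"
  have "?G \<subseteq> Pow (space M)" by auto
  then have "A \<in> sigma_sets (space M) ?G"
    using assms by (simp add: rank_filtration_def sets_measure_of)
  then show ?thesis
  proof induction
    case (Basic a)
    then obtain i B where a: "a = Y i -` B \<inter> space M" "i \<in> {1..k}" by blast
    show ?case
      unfolding determined_def a(1)
    proof (intro conjI ballI impI)
      fix \<omega> \<omega>'
      assume \<omega>: "\<omega> \<in> space M" "\<omega>' \<in> space M" and "\<forall>i\<in>{1..k}. Y i \<omega> = Y i \<omega>'"
      from this(3) a(2) have "Y i \<omega> = Y i \<omega>'" by (rule bspec)
      with \<omega> show "\<omega> \<in> Y i -` B \<inter> space M \<longleftrightarrow> \<omega>' \<in> Y i -` B \<inter> space M" by simp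
    qed blast
  next
    case Empty
    then show ?case by (simp add: determined_def)
  next
    case (Compl a)
    from determined_Diff[OF determined_space Compl.IH] show ?case .
  next
    case (Union a)
    from determined_UN[OF Union.IH] show ?case .
  qed
qed

lemma rank_determined: "1 \<le> k \<Longrightarrow> determined k {\<omega> \<in> space M. P (Y k \<omega>)}"
  unfolding determined_def by auto

lemma relative_rank_bounds: "k \<in> {1..N} \<Longrightarrow> Y k \<omega> \<in> {1..k}"
  using PiE_mem[OF rank_code_in[of N "\<lambda>k. X k \<omega>", unfolded rank_codes_def], of k]
  by (simp add: code_eq)

text \<open>
  Overwriting the coordinate \<open>Suc n\<close> of the code by a constant maps the codes of outcomes in \<open>A\<close> to such
  codes again, since \<open>A\<close> does not depend on that coordinate. Hence all values of the coordinate
  occur equally often in \<open>A\<close>.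
\<close>
lemma prob_next_rank:
  assumes A: "determined n A" and n: "n < N" and i: "i \<in> {1..Suc n}"
  shows "prob (A \<inter> {\<omega> \<in> space M. Y (Suc n) \<omega> = i}) = prob A / real (Suc n)"
proof -
  define k where "k = Suc n"
  have k: "k \<in> {1..N}" using n by (simp add: k_def)
  define B where "B = code ` A"
  have B: "B \<subseteq> rank_codes N" using rank_code_in by (auto simp: B_def)
  have A_eq: "A = {\<omega> \<in> space M. code \<omega> \<in> B}"
    unfolding B_def using A n by (intro determined_eq_code) auto
  have fin: "finite B" using B by (rule finite_subset) (simp add: rank_codes_def finite_PiE)
  have swap: "y(k := j) \<in> B" if "y \<in> B" "j \<in> {1..k}" for y j
  proof -
    obtain \<omega> where \<omega>: "\<omega> \<in> A" "y = code \<omega>" using \<open>y \<in> B\<close> by (auto simp: B_def)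
    have y': "y(k := j) \<in> rank_codes N"
      using that B k by (auto simp: rank_codes_def PiE_iff extensional_def)
    then have "prob {\<omega> \<in> space M. code \<omega> = y(k := j)} \<noteq> 0" by (simp add: prob_code_eq)
    then obtain \<omega>' where \<omega>': "\<omega>' \<in> space M" "code \<omega>' = y(k := j)"
      by (metis (mono_tags, lifting) Collect_empty_eq measure_empty)
    have "Y l \<omega> = Y l \<omega>'" if "l \<in> {1..n}" for l
      using fun_cong[OF \<omega>'(2), of l] code_eq[of l] that n by (simp add: \<omega>(2) k_def)
    then have "\<omega>' \<in> A" using A \<omega> \<omega>' unfolding determined_def by blast
    then show ?thesis using \<omega>'(2) by (auto simp: B_def intro!: image_eqI[where x = \<omega>'])
  qed
  let ?B = "\<lambda>i. {y \<in> B. y k = i}"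
  have cards: "card (?B j) = card (?B i)" if "j \<in> {1..k}" for j
  proof (rule bij_betw_same_card)
    show "bij_betw (\<lambda>y. y(k := i)) (?B j) (?B i)"
      using that i swap
      by (intro bij_betw_byWitness[where f' = "\<lambda>y. y(k := j)"]) (auto simp: k_def)
  qed
  have "B = (\<Union>j\<in>{1..k}. ?B j)"
    using B k by (auto simp: rank_codes_def PiE_iff)
  then have "card B = card (\<Union>j\<in>{1..k}. ?B j)" by simp
  also have "\<dots> = (\<Sum>j\<in>{1..k}. card (?B j))"
    using fin by (intro card_UN_disjoint) auto
  also have "\<dots> = k * card (?B i)" using cards by simp
  finally have card_B: "card B = k * card (?B i)" .
  have "A \<inter> {\<omega> \<in> space M. Y k \<omega> = i} = {\<omega> \<in> space M. code \<omega> \<in> ?B i}"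
    unfolding A_eq using code_eq[OF k] by auto
  moreover have "?B i \<subseteq> rank_codes N" using B by blast
  ultimately have "prob (A \<inter> {\<omega> \<in> space M. Y k \<omega> = i}) = real (card (?B i)) / fact N"
    using code_set_events(2)[of "?B i"] by metis
  moreover have "prob A = real (card B) / fact N"
    using code_set_events(2)[OF B] A_eq by simp
  then have "prob A = real k * (real (card (?B i)) / fact N)"
    unfolding card_B by simp
  ultimately show ?thesis unfolding k_def[symmetric] using k by simp
qed

section \<open>Conditional expected durations\<close>

text \<open>
  The object \<open>k\<close> is a candidate at time \<open>j\<close> if and only if this number is less than 2.
\<close>
definition better_count :: "nat \<Rightarrow> nat \<Rightarrow> 'a \<Rightarrow> nat" where
  "better_count k j \<omega> = card {i \<in> {1..j}. X i \<omega> < X k \<omega>}"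

lemma X_inj: "\<omega> \<in> space M \<Longrightarrow> inj_on (\<lambda>k. X k \<omega>) {1..N}"
  using X_bij by (auto dest: bij_betw_imp_inj_on)

lemma card_le_eq_Suc_better:
  assumes "\<omega> \<in> space M" "k \<in> {1..j}" "j \<le> N"
  shows "card {i \<in> {1..j}. X i \<omega> \<le> X k \<omega>} = Suc (better_count k j \<omega>)"
proof -
  have "inj_on (\<lambda>k. X k \<omega>) {1..j}"
    using X_inj[OF assms(1)] by (rule inj_on_subset) (use assms(3) in auto)
  from le_set_eq_insert[OF this assms(2)] show ?thesis by (simp add: better_count_def)
qed

lemma rank_eq_Suc_better:
  assumes "\<omega> \<in> space M" "k \<in> {1..N}"
  shows "Y k \<omega> = Suc (better_count k k \<omega>)"
  using card_le_eq_Suc_better[of \<omega> k k] assms by (simp add: relative_rank_def)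

text \<open>
  A newcomer is better than the object \<open>k\<close> if and only if all objects that are better than the
  newcomer are also better than \<open>k\<close>. So the later relative ranks alone decide how long an object
  remains a candidate.
\<close>
lemma better_count_Suc:
  assumes \<omega>: "\<omega> \<in> space M" and k: "k \<in> {1..j}" and j: "Suc j \<le> N"
  shows "better_count k (Suc j) \<omega> = better_count k j \<omega> + (if Y (Suc j) \<omega> \<le> Suc (better_count k j \<omega>) then 1 else 0)"
proof -
  let ?L = "{i \<in> {1..j}. X i \<omega> \<le> X k \<omega>}"
  have cardL: "card ?L = Suc (better_count k j \<omega>)" using card_le_eq_Suc_better[OF \<omega> k] j by simp
  have neq: "X (Suc j) \<omega> \<noteq> X k \<omega>"
    using inj_onD[OF X_inj[OF \<omega>], of "Suc j" k] k j by auto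
  let ?R = "{i \<in> {1..Suc j}. X i \<omega> \<le> X (Suc j) \<omega>}"
  have R: "card ?R = Y (Suc j) \<omega>" by (simp add: relative_rank_def)
  show ?thesis
  proof (cases "X (Suc j) \<omega> < X k \<omega>")
    case True
    then have "{i \<in> {1..Suc j}. X i \<omega> < X k \<omega>} = insert (Suc j) {i \<in> {1..j}. X i \<omega> < X k \<omega>}"
      by (auto simp: le_Suc_eq)
    then have "better_count k (Suc j) \<omega> = Suc (better_count k j \<omega>)" by (simp add: better_count_def)
    moreover have "Y (Suc j) \<omega> \<le> Suc (better_count k j \<omega>)"
    proof -
      have "?R \<subseteq> insert (Suc j) (?L - {k})" using True by (auto simp: le_Suc_eq)
      then have "card ?R \<le> card (insert (Suc j) (?L - {k}))" by (intro card_mono) auto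
      also have "\<dots> = Suc (better_count k j \<omega>)"
        using cardL k by (subst card_insert_disjoint) (auto simp: card_Diff_singleton)
      finally have "Y (Suc j) \<omega> \<le> Suc (better_count k j \<omega>)" unfolding R .
      then show ?thesis .
    qed
    ultimately show ?thesis by simp
  next
    case False
    then have "{i \<in> {1..Suc j}. X i \<omega> < X k \<omega>} = {i \<in> {1..j}. X i \<omega> < X k \<omega>}"
      by (auto simp: le_Suc_eq)
    then have "better_count k (Suc j) \<omega> = better_count k j \<omega>" by (simp add: better_count_def)
    moreover have "insert (Suc j) ?L \<subseteq> ?R" using False by auto
    then have "card (insert (Suc j) ?L) \<le> card ?R" by (intro card_mono) auto
    then have "\<not> Y (Suc j) \<omega> \<le> Suc (better_count k j \<omega>)" using cardL R by simp
    ultimately show ?thesis by simp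
  qed
qed

lemma better_count_cong:
  assumes "\<omega> \<in> space M" "\<omega>' \<in> space M" "k \<in> {1..N}" "k \<le> j" "j \<le> N"
    and "\<And>i. i \<in> {1..j} \<Longrightarrow> Y i \<omega> = Y i \<omega>'"
  shows "better_count k j \<omega> = better_count k j \<omega>'"
  using assms(4-6)
proof (induction rule: dec_induct)
  case base
  then show ?case using rank_eq_Suc_better[of \<omega> k] rank_eq_Suc_better[of \<omega>' k] assms(1-3)
    by force
next
  case (step n)
  have "better_count k n \<omega> = better_count k n \<omega>'" using step by simp
  moreover have "Y (Suc n) \<omega> = Y (Suc n) \<omega>'" using step by simp
  ultimately show ?case
    using better_count_Suc[of \<omega> k n] better_count_Suc[of \<omega>' k n] assms(1-3) step by simp
qed

lemma better_count_determined:
  assumes "k \<in> {1..N}" "k \<le> j" "j \<le> N"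
  shows "determined j {\<omega> \<in> space M. P (better_count k j \<omega>)}"
  unfolding determined_def
proof (intro conjI ballI impI)
  fix \<omega> \<omega>' assume \<omega>: "\<omega> \<in> space M" "\<omega>' \<in> space M" "\<forall>i\<in>{1..j}. Y i \<omega> = Y i \<omega>'"
  have "better_count k j \<omega> = better_count k j \<omega>'"
    by (rule better_count_cong[OF \<omega>(1,2) assms]) (rule bspec[OF \<omega>(3)])
  with \<omega>(1,2) show "\<omega> \<in> {\<omega> \<in> space M. P (better_count k j \<omega>)} \<longleftrightarrow> \<omega>' \<in> {\<omega> \<in> space M. P (better_count k j \<omega>)}"
    by simp
qed blast

lemma better_count_mono: "i \<le> j \<Longrightarrow> better_count k i \<omega> \<le> better_count k j \<omega>"
  unfolding better_count_def by (intro card_mono) auto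

lemma duration_eq_sum:
  assumes "k \<in> {1..N}"
  shows "real (end_of_candidacy N X k \<omega>) - real k = (\<Sum>j\<in>{k..N}. of_bool (better_count k j \<omega> < 2))"
proof (cases "\<exists>j\<in>{k..N}. 2 \<le> better_count k j \<omega>")
  case True
  define T where "T = (LEAST j. j \<in> {k..N} \<and> 2 \<le> better_count k j \<omega>)"
  have "T \<in> {k..N} \<and> 2 \<le> better_count k T \<omega>"
    unfolding T_def by (rule LeastI_ex) (use True in blast)
  then have T: "T \<in> {k..N}" "2 \<le> better_count k T \<omega>" by auto
  have "better_count k j \<omega> < 2 \<longleftrightarrow> j < T" if "j \<in> {k..N}" for j
  proof
    assume "better_count k j \<omega> < 2"
    then show "j < T" using better_count_mono[of T j k \<omega>] T by force
  next
    assume "j < T"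
    then show "better_count k j \<omega> < 2"
      using not_less_Least[of j "\<lambda>j. j \<in> {k..N} \<and> 2 \<le> better_count k j \<omega>"] that unfolding T_def by force
  qed
  then have "(\<Sum>j\<in>{k..N}. of_bool (better_count k j \<omega> < 2) :: real) = (\<Sum>j\<in>{k..N}. of_bool (j < T))"
    by (intro sum.cong) auto
  also have "\<dots> = real (card ({k..N} \<inter> {j. j < T}))"
    by (simp add: of_bool_def sum.If_cases)
  also have "{k..N} \<inter> {j. j < T} = {k..<T}" using T by auto
  finally show ?thesis
    using True T by (simp add: end_of_candidacy_def T_def[unfolded better_count_def] better_count_def of_nat_diff)
next
  case False
  then have "better_count k j \<omega> < 2" if "j \<in> {k..N}" for j
    using that by (meson not_le)
  then have "(\<Sum>j\<in>{k..N}. of_bool (better_count k j \<omega> < 2) :: real) = (\<Sum>j\<in>{k..N}. 1)"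
    by (intro sum.cong) auto
  then show ?thesis using False assms by (simp add: end_of_candidacy_def better_count_def)
qed

text \<open>
  From time \<open>j\<close> on, the future of object \<open>k\<close> depends only on the number of better objects at
  time \<open>j\<close>, not on \<open>k\<close>: with 0 or 1 better objects it behaves like the object \<open>j\<close> with
  relative rank 1 or 2. The induction runs backwards from \<open>N\<close>. By \<open>prob_next_rank\<close>, the number
  grows from 0 with probability \<open>1 / (j + 1)\<close> and from 1 with probability \<open>2 / (j + 1)\<close>.
\<close>
lemma expected_time_as_candidate:
  assumes A: "determined k A" and k: "k \<in> {1..N}" and "k \<le> j" "j \<le> N"
  shows "(\<Sum>i\<in>{j..N}. prob (A \<inter> {\<omega> \<in> space M. better_count k i \<omega> < 2})) =
     best_duration N j * prob (A \<inter> {\<omega> \<in> space M. better_count k j \<omega> = 0}) +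
     second_duration N j * prob (A \<inter> {\<omega> \<in> space M. better_count k j \<omega> = 1})"
  using assms(4,3)
proof (induction rule: inc_induct)
  have A_sub: "A \<subseteq> space M" using A unfolding determined_def by (rule conjunct1)
  let ?E = "\<lambda>j c. A \<inter> {\<omega> \<in> space M. better_count k j \<omega> = c}"
  have E_det: "determined j (?E j c)" if "k \<le> j" "j \<le> N" for j c
    using that by (intro determined_Int better_count_determined determined_mono[OF A] k) auto
  have E_ev: "?E j c \<in> events" if "k \<le> j" "j \<le> N" for j c
    using determined_events[OF E_det] that by auto
  have split: "prob (A \<inter> {\<omega> \<in> space M. better_count k j \<omega> < 2}) = prob (?E j 0) + prob (?E j 1)"
    if "k \<le> j" "j \<le> N" for j
  proof -
    have "A \<inter> {\<omega> \<in> space M. better_count k j \<omega> < 2} = ?E j 0 \<union> ?E j 1" by auto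
    then show ?thesis using E_ev[OF that] by (simp add: finite_measure_Union disjoint_iff)
  qed
  {
    case base
    then show ?case using split[of N] by (simp add: best_duration_last[OF N_pos] second_duration_last[OF N_pos])
  next
    case (step j)
    have j: "k \<le> j" "j < N" "Suc j \<le> N" "1 \<le> j" "k \<in> {1..j}" using step k by auto
    let ?Y = "\<lambda>c. {\<omega> \<in> space M. Y (Suc j) \<omega> = c}"
    have Y_ev: "?Y c \<in> events" for c
      using determined_events[OF rank_determined[of "Suc j" "\<lambda>r. r = c"]] j by auto
    have next_prob: "prob (?E j c \<inter> ?Y i) = prob (?E j c) / real (Suc j)" if "i = 1 \<or> i = 2" for c i
      using that j by (intro prob_next_rank E_det) auto
    have Y_pos: "1 \<le> Y (Suc j) \<omega>" for \<omega> using relative_rank_bounds[of "Suc j" \<omega>] j by auto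
    have bS: "better_count k (Suc j) \<omega> = better_count k j \<omega> + (if Y (Suc j) \<omega> \<le> Suc (better_count k j \<omega>) then 1 else 0)"
      if "\<omega> \<in> A" for \<omega>
      using better_count_Suc[of \<omega> k j] that A_sub j by auto
    have "?E (Suc j) 0 = ?E j 0 - ?E j 0 \<inter> ?Y 1"
    proof (intro set_eqI iffI)
      fix \<omega> assume "\<omega> \<in> ?E (Suc j) 0"
      then show "\<omega> \<in> ?E j 0 - ?E j 0 \<inter> ?Y 1" using bS[of \<omega>] by (auto split: if_splits)
    next
      fix \<omega> assume "\<omega> \<in> ?E j 0 - ?E j 0 \<inter> ?Y 1"
      then show "\<omega> \<in> ?E (Suc j) 0" using bS[of \<omega>] Y_pos[of \<omega>] by auto
    qed
    then have "prob (?E (Suc j) 0) = prob (?E j 0) - prob (?E j 0 \<inter> ?Y 1)"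
      using E_ev[of j 0] Y_ev[of 1] j by (simp add: finite_measure_Diff')
    then have "prob (?E (Suc j) 0) = prob (?E j 0) - prob (?E j 0) / real (Suc j)"
      using next_prob[of 1 0] by simp
    moreover have j_frac: "real j / real (Suc j) = 1 - 1 / real (Suc j)"
      "(real j - 1) / real (Suc j) = 1 - 2 / real (Suc j)"
      by (simp_all add: divide_simps)
    ultimately have p0: "prob (?E (Suc j) 0) = real j / real (Suc j) * prob (?E j 0)"
      by (simp only: left_diff_distrib mult_1 times_divide_eq_left)
    have E1: "?E (Suc j) 1 = (?E j 0 \<inter> ?Y 1) \<union> (?E j 1 - (?E j 1 \<inter> ?Y 1 \<union> ?E j 1 \<inter> ?Y 2))"
    proof (rule set_eqI)
      fix \<omega>
      show "\<omega> \<in> ?E (Suc j) 1 \<longleftrightarrow>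
          \<omega> \<in> (?E j 0 \<inter> ?Y 1) \<union> (?E j 1 - (?E j 1 \<inter> ?Y 1 \<union> ?E j 1 \<inter> ?Y 2))"
      proof (cases "\<omega> \<in> A")
        case True
        have "b + (if r \<le> Suc b then 1 else 0) = 1 \<longleftrightarrow>
            b = 0 \<and> r = 1 \<or> b = 1 \<and> r \<noteq> 1 \<and> r \<noteq> 2" if "1 \<le> r" for b r :: nat
          using that by auto
        from this[OF Y_pos, of "better_count k j \<omega>" \<omega>] show ?thesis
          unfolding bS[OF True, symmetric] using True A_sub by blast
      qed blast
    qed
    have pa: "prob ((?E j 0 \<inter> ?Y 1) \<union> (?E j 1 - (?E j 1 \<inter> ?Y 1 \<union> ?E j 1 \<inter> ?Y 2))) =
        prob (?E j 0 \<inter> ?Y 1) + prob (?E j 1 - (?E j 1 \<inter> ?Y 1 \<union> ?E j 1 \<inter> ?Y 2))"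
      using E_ev[of j] Y_ev j by (intro finite_measure_Union) auto
    have pb: "prob (?E j 1 - (?E j 1 \<inter> ?Y 1 \<union> ?E j 1 \<inter> ?Y 2)) =
        prob (?E j 1) - prob (?E j 1 \<inter> ?Y 1 \<union> ?E j 1 \<inter> ?Y 2)"
      using E_ev[of j] Y_ev j by (intro finite_measure_Diff) auto
    have pc: "prob (?E j 1 \<inter> ?Y 1 \<union> ?E j 1 \<inter> ?Y 2) = prob (?E j 1 \<inter> ?Y 1) + prob (?E j 1 \<inter> ?Y 2)"
      using E_ev[of j] Y_ev j by (intro finite_measure_Union) auto
    have "prob (?E (Suc j) 1) = prob (?E j 0) / real (Suc j) +
        (prob (?E j 1) - (prob (?E j 1) / real (Suc j) + prob (?E j 1) / real (Suc j)))"
      unfolding E1 pa pb pc by (simp only: next_prob simp_thms)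
    then have p1: "prob (?E (Suc j) 1) =
        (real j - 1) / real (Suc j) * prob (?E j 1) + prob (?E j 0) / real (Suc j)"
      unfolding j_frac by (simp add: left_diff_distrib)
    have "{j..N} = insert j {Suc j..N}" using j by auto
    then have "(\<Sum>i\<in>{j..N}. prob (A \<inter> {\<omega> \<in> space M. better_count k i \<omega> < 2})) =
       prob (?E j 0) + prob (?E j 1) +
       (best_duration N (Suc j) * (real j / real (Suc j) * prob (?E j 0)) +
       second_duration N (Suc j) * ((real j - 1) / real (Suc j) * prob (?E j 1) + prob (?E j 0) / real (Suc j)))"
      using step.IH split[of j] j unfolding p0 p1 by simp
    also have "\<dots> = best_duration N j * prob (?E j 0) + second_duration N j * prob (?E j 1)"
      unfolding best_duration_step[OF j(4) N_pos] second_duration_step[OF j(4) N_pos]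
      by (simp add: algebra_simps)
    finally show ?case .
  }
qed

section \<open>Optimal stopping of the relative ranks\<close>

text \<open>
  The contribution of stopping at time \<open>k\<close> to the expected duration.
\<close>
definition gain :: "('a \<Rightarrow> nat) \<Rightarrow> nat \<Rightarrow> real" where
  "gain \<tau> k =
     best_duration N k * prob {\<omega> \<in> space M. \<tau> \<omega> = k \<and> Y k \<omega> = 1} +
     second_duration N k * prob {\<omega> \<in> space M. \<tau> \<omega> = k \<and> Y k \<omega> = 2}"

definition rank_stopping_time :: "('a \<Rightarrow> nat) \<Rightarrow> bool" where
  "rank_stopping_time \<tau> \<longleftrightarrow> (\<forall>\<omega>\<in>space M. \<tau> \<omega> \<in> {1..N}) \<and>
     (\<forall>k. determined k {\<omega> \<in> space M. \<tau> \<omega> \<le> k})"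

lemma stopping_times_rank:
  assumes "\<tau> \<in> stopping_times M N X"
  shows "rank_stopping_time \<tau>"
proof -
  have "determined k {\<omega> \<in> space M. \<tau> \<omega> \<le> k}" for k
  proof -
    have "Measurable.pred (rank_filtration M X k) (\<lambda>\<omega>. \<tau> \<omega> \<le> k)"
      using assms by (intro stopping_timeD) (simp add: stopping_times_def)
    moreover have "space (rank_filtration M X k) = space M"
      by (auto simp: rank_filtration_def space_measure_of_conv)
    ultimately show ?thesis
      by (intro filtration_determined) (simp add: pred_def)
  qed
  then show ?thesis using assms by (simp add: rank_stopping_time_def stopping_times_def)
qed

lemma rank_stopping_gt_determined:
  assumes "rank_stopping_time \<tau>"
  shows "determined k {\<omega> \<in> space M. k < \<tau> \<omega>}"
proof -
  have "{\<omega> \<in> space M. k < \<tau> \<omega>} = space M - {\<omega> \<in> space M. \<tau> \<omega> \<le> k}" by auto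
  moreover have "determined k {\<omega> \<in> space M. \<tau> \<omega> \<le> k}"
    using assms by (simp add: rank_stopping_time_def)
  ultimately show ?thesis using determined_Diff[OF determined_space] by simp
qed

lemma rank_stopping_eq_determined:
  assumes "rank_stopping_time \<tau>" "1 \<le> k"
  shows "determined k {\<omega> \<in> space M. \<tau> \<omega> = k}"
proof -
  have "{\<omega> \<in> space M. \<tau> \<omega> = k} =
      {\<omega> \<in> space M. \<tau> \<omega> \<le> k} - {\<omega> \<in> space M. \<tau> \<omega> \<le> k - 1}" using assms(2) by auto
  moreover have "determined k {\<omega> \<in> space M. \<tau> \<omega> \<le> k}"
    using assms by (simp add: rank_stopping_time_def)
  moreover have "determined (k - 1) {\<omega> \<in> space M. \<tau> \<omega> \<le> k - 1}"
    using assms by (simp add: rank_stopping_time_def)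
  ultimately show ?thesis
    using determined_Diff[OF _ determined_mono[of "k - 1" _ k]] by simp
qed

lemma expectation_payoff:
  assumes \<tau>: "rank_stopping_time \<tau>"
  shows "expectation (payoff N X \<tau>) = (\<Sum>k\<in>{1..N}. gain \<tau> k) / real N"
proof -
  let ?E = "\<lambda>k j. {\<omega> \<in> space M. \<tau> \<omega> = k} \<inter> {\<omega> \<in> space M. better_count k j \<omega> < 2}"
  have ev: "?E k j \<in> events" if "k \<in> {1..N}" "j \<in> {k..N}" for k j
  proof (rule determined_events)
    show "determined j (?E k j)"
      using that by (intro determined_Int better_count_determined
          determined_mono[OF rank_stopping_eq_determined[OF \<tau>]]) auto
  qed (use that in auto)
  have "payoff N X \<tau> \<omega> = (\<Sum>k\<in>{1..N}. \<Sum>j\<in>{k..N}. indicator (?E k j) \<omega>) / real N"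
    if \<omega>: "\<omega> \<in> space M" for \<omega>
  proof -
    have \<tau>\<omega>: "\<tau> \<omega> \<in> {1..N}" using \<tau> \<omega> by (simp add: rank_stopping_time_def)
    have "(\<Sum>k\<in>{1..N}. \<Sum>j\<in>{k..N}. indicator (?E k j) \<omega>) =
          (\<Sum>k\<in>{1..N}. if \<tau> \<omega> = k then (\<Sum>j\<in>{k..N}. of_bool (better_count k j \<omega> < 2)) else (0::real))"
      using \<omega> by (intro sum.cong refl) (auto simp: indicator_def)
    also have "\<dots> = (\<Sum>j\<in>{\<tau> \<omega>..N}. of_bool (better_count (\<tau> \<omega>) j \<omega> < 2))"
      using \<tau>\<omega> by simp
    also have "\<dots> = real (end_of_candidacy N X (\<tau> \<omega>) \<omega>) - real (\<tau> \<omega>)"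
      using duration_eq_sum[OF \<tau>\<omega>] by simp
    finally show ?thesis by (simp add: payoff_def)
  qed
  then have "expectation (payoff N X \<tau>) =
      expectation (\<lambda>\<omega>. (\<Sum>k\<in>{1..N}. \<Sum>j\<in>{k..N}. indicator (?E k j) \<omega>) / real N)"
    by (intro Bochner_Integration.integral_cong refl)
  also have "\<dots> = (\<Sum>k\<in>{1..N}. \<Sum>j\<in>{k..N}. prob (?E k j)) / real N"
  proof -
    have int: "integrable M (indicator (?E k j) :: 'a \<Rightarrow> real)" if "k \<in> {1..N}" "j \<in> {k..N}" for k j
      using ev[OF that] by (simp add: emeasure_eq_measure)
    have "expectation (\<lambda>\<omega>. \<Sum>k\<in>{1..N}. \<Sum>j\<in>{k..N}. indicator (?E k j) \<omega> :: real) =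
       (\<Sum>k\<in>{1..N}. \<Sum>j\<in>{k..N}. expectation (indicator (?E k j)))"
      using int by (subst Bochner_Integration.integral_sum)
        (auto intro!: sum.cong Bochner_Integration.integral_sum Bochner_Integration.integrable_sum)
    also have "\<dots> = (\<Sum>k\<in>{1..N}. \<Sum>j\<in>{k..N}. prob (?E k j))"
      using ev by (intro sum.cong refl) (simp add: Int_absorb2 sets.sets_into_space)
    finally show ?thesis by simp
  qed
  also have "(\<Sum>k\<in>{1..N}. \<Sum>j\<in>{k..N}. prob (?E k j)) = (\<Sum>k\<in>{1..N}. gain \<tau> k)"
  proof (intro sum.cong refl)
    fix k assume k: "k \<in> {1..N}"
    have c: "{\<omega> \<in> space M. \<tau> \<omega> = k} \<inter> {\<omega> \<in> space M. better_count k k \<omega> = c} =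
          {\<omega> \<in> space M. \<tau> \<omega> = k \<and> Y k \<omega> = Suc c}" for c
      using rank_eq_Suc_better[OF _ k] by auto
    show "(\<Sum>j\<in>{k..N}. prob (?E k j)) = gain \<tau> k"
      using expected_time_as_candidate[OF rank_stopping_eq_determined[OF \<tau>] k, of k] k
      unfolding c gain_def by (simp add: numeral_2_eq_2)
  qed
  finally show ?thesis .
qed

text \<open>
  One step of the supermartingale inequality. On the event that \<open>\<tau> > n\<close>, the relative rank
  of object \<open>k\<close> is uniform, so the right-hand side is the optimal reward averaged over that rank;
  the left-hand side replaces the maxima by the decisions of \<open>\<tau>\<close>. The
  hypotheses of the second part say that those decisions are optimal wherever they occur.
\<close>
lemma bellman_step:
  assumes \<tau>: "rank_stopping_time \<tau>" and n: "n < N"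
  defines "k \<equiv> Suc n"
  shows "gain \<tau> k + cont_value N k * prob {\<omega> \<in> space M. k < \<tau> \<omega>} \<le>
           cont_value N n * prob {\<omega> \<in> space M. n < \<tau> \<omega>}"
    and "\<lbrakk>\<And>\<omega>. \<omega> \<in> space M \<Longrightarrow> \<tau> \<omega> = k \<Longrightarrow> Y k \<omega> = 1 \<Longrightarrow> cont_value N k \<le> best_duration N k;
          \<And>\<omega>. \<omega> \<in> space M \<Longrightarrow> k < \<tau> \<omega> \<Longrightarrow> Y k \<omega> = 1 \<Longrightarrow> best_duration N k \<le> cont_value N k;
          \<And>\<omega>. \<omega> \<in> space M \<Longrightarrow> \<tau> \<omega> = k \<Longrightarrow> Y k \<omega> = 2 \<Longrightarrow> cont_value N k \<le> second_duration N k;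
          \<And>\<omega>. \<omega> \<in> space M \<Longrightarrow> k < \<tau> \<omega> \<Longrightarrow> Y k \<omega> = 2 \<Longrightarrow> second_duration N k \<le> cont_value N k;
          \<And>\<omega>. \<omega> \<in> space M \<Longrightarrow> \<tau> \<omega> = k \<Longrightarrow> 3 \<le> Y k \<omega> \<Longrightarrow> cont_value N k = 0\<rbrakk> \<Longrightarrow>
         gain \<tau> k + cont_value N k * prob {\<omega> \<in> space M. k < \<tau> \<omega>} =
           cont_value N n * prob {\<omega> \<in> space M. n < \<tau> \<omega>}"
proof -
  define V B S where "V = cont_value N k" and "B = best_duration N k" and "S = second_duration N k"
  have k: "1 \<le> k" "k \<le> N" "k \<in> {1..N}" using n by (auto simp: k_def)
  have "0 \<le> V"
    using greedy_value_nonneg[OF k(1,2)] greedy_le_cont[OF k(1,2)] by (simp add: V_def)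
  let ?D = "{\<omega> \<in> space M. n < \<tau> \<omega>}"
  define s where "s = (\<lambda>P. prob {\<omega> \<in> space M. \<tau> \<omega> = k \<and> P (Y k \<omega>)})"
  define c where "c = (\<lambda>P. prob {\<omega> \<in> space M. k < \<tau> \<omega> \<and> P (Y k \<omega>)})"
  have D: "determined n ?D" by (rule rank_stopping_gt_determined[OF \<tau>])
  have det_s: "determined k {\<omega> \<in> space M. \<tau> \<omega> = k \<and> P (Y k \<omega>)}" for P
    using determined_Int[OF rank_stopping_eq_determined[OF \<tau> k(1)] rank_determined[OF k(1), of P]]
    by (simp add: Int_def conj_commute conj_left_commute cong: conj_cong)
  have det_c: "determined k {\<omega> \<in> space M. k < \<tau> \<omega> \<and> P (Y k \<omega>)}" for P
    using determined_Int[OF rank_stopping_gt_determined[OF \<tau>, of k] rank_determined[OF k(1), of P]]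
    by (simp add: Int_def conj_commute conj_left_commute cong: conj_cong)
  have ev_s: "{\<omega> \<in> space M. \<tau> \<omega> = k \<and> P (Y k \<omega>)} \<in> events" for P
    by (rule determined_events[OF det_s k(2)])
  have ev_c: "{\<omega> \<in> space M. k < \<tau> \<omega> \<and> P (Y k \<omega>)} \<in> events" for P
    by (rule determined_events[OF det_c k(2)])
  have nonneg: "0 \<le> s P" "0 \<le> c P" for P by (simp_all add: s_def c_def)
  have sc: "s P + c P = prob (?D \<inter> {\<omega> \<in> space M. P (Y k \<omega>)})" for P
  proof -
    have "?D \<inter> {\<omega> \<in> space M. P (Y k \<omega>)} =
        {\<omega> \<in> space M. \<tau> \<omega> = k \<and> P (Y k \<omega>)} \<union> {\<omega> \<in> space M. k < \<tau> \<omega> \<and> P (Y k \<omega>)}"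
      by (auto simp: k_def)
    moreover have "prob \<dots> = s P + c P"
      unfolding s_def c_def using ev_s ev_c by (intro finite_measure_Union) auto
    ultimately show ?thesis by simp
  qed
  have tri: "Y k \<omega> = 1 \<or> Y k \<omega> = 2 \<or> 3 \<le> Y k \<omega>" for \<omega>
    using relative_rank_bounds[OF k(3), of \<omega>] by auto
  have total: "c (\<lambda>_. True) = c (\<lambda>r. r = 1) + c (\<lambda>r. r = 2) + c (\<lambda>r. 3 \<le> r)"
  proof -
    have "{\<omega> \<in> space M. k < \<tau> \<omega> \<and> True} =
       {\<omega> \<in> space M. k < \<tau> \<omega> \<and> Y k \<omega> = 1} \<union>
       ({\<omega> \<in> space M. k < \<tau> \<omega> \<and> Y k \<omega> = 2} \<union> {\<omega> \<in> space M. k < \<tau> \<omega> \<and> 3 \<le> Y k \<omega>})"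
      using tri by blast
    moreover have "prob \<dots> = c (\<lambda>r. r = 1) + prob ({\<omega> \<in> space M. k < \<tau> \<omega> \<and> Y k \<omega> = 2} \<union> {\<omega> \<in> space M. k < \<tau> \<omega> \<and> 3 \<le> Y k \<omega>})"
      unfolding c_def using ev_c[of "\<lambda>r. r = 1"] ev_c[of "\<lambda>r. r = 2"] ev_c[of "\<lambda>r. 3 \<le> r"]
      by (intro finite_measure_Union) auto
    moreover have "prob ({\<omega> \<in> space M. k < \<tau> \<omega> \<and> Y k \<omega> = 2} \<union> {\<omega> \<in> space M. k < \<tau> \<omega> \<and> 3 \<le> Y k \<omega>})
         = c (\<lambda>r. r = 2) + c (\<lambda>r. 3 \<le> r)"
      unfolding c_def using ev_c[of "\<lambda>r. r = 2"] ev_c[of "\<lambda>r. 3 \<le> r"]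
      by (intro finite_measure_Union) auto
    ultimately show ?thesis by (simp add: c_def)
  qed
  have D_split: "prob ?D = (s (\<lambda>r. r = 1) + c (\<lambda>r. r = 1)) +
      (s (\<lambda>r. r = 2) + c (\<lambda>r. r = 2)) + (s (\<lambda>r. 3 \<le> r) + c (\<lambda>r. 3 \<le> r))"
  proof -
    have DY: "?D \<inter> {\<omega> \<in> space M. P (Y k \<omega>)} \<in> events" for P
      by (rule determined_events[OF determined_Int[OF determined_mono[OF D] rank_determined]])
         (use k in \<open>auto simp: k_def\<close>)
    have "?D = (?D \<inter> {\<omega> \<in> space M. Y k \<omega> = 1}) \<union>
       ((?D \<inter> {\<omega> \<in> space M. Y k \<omega> = 2}) \<union> (?D \<inter> {\<omega> \<in> space M. 3 \<le> Y k \<omega>}))"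
      using tri by blast
    then have "prob ?D = prob \<dots>" by simp
    also have "\<dots> = prob (?D \<inter> {\<omega> \<in> space M. Y k \<omega> = 1}) +
       prob ((?D \<inter> {\<omega> \<in> space M. Y k \<omega> = 2}) \<union> (?D \<inter> {\<omega> \<in> space M. 3 \<le> Y k \<omega>}))"
      using DY[of "\<lambda>r. r = 1"] DY[of "\<lambda>r. r = 2"] DY[of "\<lambda>r. 3 \<le> r"]
      by (intro finite_measure_Union) auto
    also have "prob ((?D \<inter> {\<omega> \<in> space M. Y k \<omega> = 2}) \<union> (?D \<inter> {\<omega> \<in> space M. 3 \<le> Y k \<omega>}))
        = prob (?D \<inter> {\<omega> \<in> space M. Y k \<omega> = 2}) + prob (?D \<inter> {\<omega> \<in> space M. 3 \<le> Y k \<omega>})"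
      using DY[of "\<lambda>r. r = 2"] DY[of "\<lambda>r. 3 \<le> r"]
      by (intro finite_measure_Union) auto
    finally show ?thesis using sc[of "\<lambda>r. r = 1"] sc[of "\<lambda>r. r = 2"] sc[of "\<lambda>r. 3 \<le> r"] by simp
  qed
  let ?s1 = "s (\<lambda>r. r = 1)" and ?s2 = "s (\<lambda>r. r = 2)" and ?s3 = "s (\<lambda>r. 3 \<le> r)"
  let ?c1 = "c (\<lambda>r. r = 1)" and ?c2 = "c (\<lambda>r. r = 2)" and ?c3 = "c (\<lambda>r. 3 \<le> r)"
  have split_value: "cont_value N n * prob ?D =
     max B V * (?s1 + ?c1) + max S V * (?s2 + ?c2) + V * (?s3 + ?c3)"
  proof (cases "n = 0")
    case True
    have "Y k \<omega> = 1" for \<omega> using relative_rank_bounds[OF k(3), of \<omega>] True by (simp add: k_def)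
    then have "?s2 = 0" "?c2 = 0" "?s3 = 0" "?c3 = 0" by (simp_all add: s_def c_def)
    then show ?thesis using D_split True n by (simp add: cont_value_0 B_def V_def k_def)
  next
    case False
    have d1: "?s1 + ?c1 = prob ?D / real k"
      using prob_next_rank[OF D n, of 1] sc[of "\<lambda>r. r = 1"] by (simp add: k_def)
    have d2: "?s2 + ?c2 = prob ?D / real k"
      using prob_next_rank[OF D n, of 2] sc[of "\<lambda>r. r = 2"] False by (simp add: k_def)
    have d3: "?s3 + ?c3 = (real n - 1) * (prob ?D / real k)"
    proof -
      have "prob ?D = real k * (prob ?D / real k)" using k by simp
      also have "\<dots> = 2 * (prob ?D / real k) + (real n - 1) * (prob ?D / real k)"
        unfolding k_def of_nat_Suc by (simp only: distrib_right[symmetric]) simp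
      finally show ?thesis using D_split d1 d2 by linarith
    qed
    have "cont_value N n = (max B V + max S V + (real n - 1) * V) / real k"
      unfolding B_def V_def S_def k_def using False n by (intro cont_value_step) auto
    then have "cont_value N n * prob ?D = (max B V + max S V + (real n - 1) * V) * (prob ?D / real k)"
      by simp
    also have "\<dots> = max B V * q + max S V * q + V * ((real n - 1) * q)" if "q = prob ?D / real k" for q
      unfolding that[symmetric] by (simp add: algebra_simps)
    finally show ?thesis unfolding d1 d2 d3 by simp
  qed
  have lhs: "gain \<tau> k + cont_value N k * prob {\<omega> \<in> space M. k < \<tau> \<omega>} =
      B * ?s1 + S * ?s2 + V * (?c1 + ?c2 + ?c3)"
    using total by (simp add: gain_def B_def S_def V_def s_def c_def)
  have "B * ?s1 + S * ?s2 + V * (?c1 + ?c2 + ?c3) \<le>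
     max B V * ?s1 + max S V * ?s2 + (max B V * ?c1 + max S V * ?c2 + V * ?c3) + V * ?s3"
  proof -
    have "B * ?s1 \<le> max B V * ?s1" "S * ?s2 \<le> max S V * ?s2"
      "V * ?c1 \<le> max B V * ?c1" "V * ?c2 \<le> max S V * ?c2" "0 \<le> V * ?s3"
      using nonneg \<open>0 \<le> V\<close> by (auto intro!: mult_right_mono mult_nonneg_nonneg)
    then show ?thesis by (simp add: distrib_left)
  qed
  then show "gain \<tau> k + cont_value N k * prob {\<omega> \<in> space M. k < \<tau> \<omega>} \<le>
           cont_value N n * prob ?D"
    unfolding lhs split_value by (simp add: distrib_left)
  have empty: "prob {\<omega> \<in> space M. Q \<omega>} = 0 \<or> (\<exists>\<omega>\<in>space M. Q \<omega>)" for Q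
    by (metis (mono_tags, lifting) Collect_empty_eq measure_empty)
  assume *: "\<And>\<omega>. \<omega> \<in> space M \<Longrightarrow> \<tau> \<omega> = k \<Longrightarrow> Y k \<omega> = 1 \<Longrightarrow> cont_value N k \<le> best_duration N k"
    "\<And>\<omega>. \<omega> \<in> space M \<Longrightarrow> k < \<tau> \<omega> \<Longrightarrow> Y k \<omega> = 1 \<Longrightarrow> best_duration N k \<le> cont_value N k"
    "\<And>\<omega>. \<omega> \<in> space M \<Longrightarrow> \<tau> \<omega> = k \<Longrightarrow> Y k \<omega> = 2 \<Longrightarrow> cont_value N k \<le> second_duration N k"
    "\<And>\<omega>. \<omega> \<in> space M \<Longrightarrow> k < \<tau> \<omega> \<Longrightarrow> Y k \<omega> = 2 \<Longrightarrow> second_duration N k \<le> cont_value N k"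
    "\<And>\<omega>. \<omega> \<in> space M \<Longrightarrow> \<tau> \<omega> = k \<Longrightarrow> 3 \<le> Y k \<omega> \<Longrightarrow> cont_value N k = 0"
  have "?s1 = 0 \<or> V \<le> B" using empty[of "\<lambda>\<omega>. \<tau> \<omega> = k \<and> Y k \<omega> = 1"] *(1) by (auto simp: s_def V_def B_def)
  then have e1: "max B V * ?s1 = B * ?s1" by auto
  have "?c1 = 0 \<or> B \<le> V" using empty[of "\<lambda>\<omega>. k < \<tau> \<omega> \<and> Y k \<omega> = 1"] *(2) by (auto simp: c_def V_def B_def)
  then have e2: "max B V * ?c1 = V * ?c1" by (auto simp: max_def)
  have "?s2 = 0 \<or> V \<le> S" using empty[of "\<lambda>\<omega>. \<tau> \<omega> = k \<and> Y k \<omega> = 2"] *(3) by (auto simp: s_def V_def S_def)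
  then have e3: "max S V * ?s2 = S * ?s2" by auto
  have "?c2 = 0 \<or> S \<le> V" using empty[of "\<lambda>\<omega>. k < \<tau> \<omega> \<and> Y k \<omega> = 2"] *(4) by (auto simp: c_def V_def S_def)
  then have e4: "max S V * ?c2 = V * ?c2" by (auto simp: max_def)
  have "?s3 = 0 \<or> V = 0" using empty[of "\<lambda>\<omega>. \<tau> \<omega> = k \<and> 3 \<le> Y k \<omega>"] *(5) by (auto simp: s_def V_def)
  then have e5: "V * ?s3 = 0" by auto
  show "gain \<tau> k + cont_value N k * prob {\<omega> \<in> space M. k < \<tau> \<omega>} = cont_value N n * prob ?D"
    unfolding lhs split_value distrib_left e1 e2 e3 e4 e5 by simp
qed

lemma prob_positive_time:
  assumes "rank_stopping_time \<tau>"
  shows "prob {\<omega> \<in> space M. 0 < \<tau> \<omega>} = 1"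
proof -
  have "{\<omega> \<in> space M. 0 < \<tau> \<omega>} = space M"
    using assms by (force simp: rank_stopping_time_def)
  then show ?thesis by (simp add: prob_space)
qed

lemma gain_sum_le:
  assumes "rank_stopping_time \<tau>" "n \<le> N"
  shows "(\<Sum>k\<in>{1..n}. gain \<tau> k) + cont_value N n * prob {\<omega> \<in> space M. n < \<tau> \<omega>} \<le> cont_value N 0"
  using assms(2)
proof (induction n)
  case 0
  then show ?case using prob_positive_time[OF assms(1)] by simp
next
  case (Suc n)
  then show ?case using bellman_step(1)[OF assms(1), of n] by simp
qed

lemma expectation_payoff_le:
  assumes "rank_stopping_time \<tau>"
  shows "expectation (payoff N X \<tau>) \<le> cont_value N 0 / real N"
  using gain_sum_le[OF assms, of N] expectation_payoff[OF assms]
  by (simp add: divide_right_mono)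

lemma threshold_time_props:
  fixes k1 k2 :: nat
  assumes "\<omega> \<in> space M"
  defines "\<tau> \<equiv> threshold_time N X k1 k2 \<omega>"
  shows "\<tau> \<in> {1..N}"
    and "\<tau> < N \<Longrightarrow> threshold_selects X k1 k2 \<tau> \<omega>"
    and "k \<in> {1..N} \<Longrightarrow> k < \<tau> \<Longrightarrow> \<not> threshold_selects X k1 k2 k \<omega>"
    and "k \<in> {1..N} \<Longrightarrow> threshold_selects X k1 k2 k \<omega> \<Longrightarrow> \<tau> \<le> k"
proof -
  let ?P = "\<lambda>k. k \<in> {1..N} \<and> threshold_selects X k1 k2 k \<omega>"
  have 1: "\<tau> \<in> {1..N} \<and> (\<tau> < N \<longrightarrow> threshold_selects X k1 k2 \<tau> \<omega>)"
  proof (cases "\<exists>k. ?P k")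
    case True
    then have "\<tau> = (LEAST k. ?P k)" by (auto simp: \<tau>_def threshold_time_def)
    then show ?thesis using LeastI_ex[OF True] by simp
  next
    case False
    then have "\<tau> = N" unfolding \<tau>_def threshold_time_def by auto
    then show ?thesis using N_pos by simp
  qed
  show "\<tau> \<in> {1..N}" and "\<tau> < N \<Longrightarrow> threshold_selects X k1 k2 \<tau> \<omega>" using 1 by auto
  show 4: "\<tau> \<le> k" if "k \<in> {1..N}" "threshold_selects X k1 k2 k \<omega>" for k
  proof -
    have "\<tau> = (LEAST k. ?P k)" using that by (auto simp: \<tau>_def threshold_time_def)
    then show ?thesis using Least_le[of ?P k] that by simp
  qed
  show "\<not> threshold_selects X k1 k2 k \<omega>" if "k \<in> {1..N}" "k < \<tau>"
    using 4[of k] that by auto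
qed

lemma threshold_time_le_iff:
  assumes "\<omega> \<in> space M" "t < N"
  shows "threshold_time N X k1 k2 \<omega> \<le> t \<longleftrightarrow> (\<exists>k\<in>{1..t}. threshold_selects X k1 k2 k \<omega>)"
proof
  assume le: "threshold_time N X k1 k2 \<omega> \<le> t"
  then show "\<exists>k\<in>{1..t}. threshold_selects X k1 k2 k \<omega>"
    using threshold_time_props(1,2)[OF assms(1), of k1 k2] assms(2) by force
next
  assume "\<exists>k\<in>{1..t}. threshold_selects X k1 k2 k \<omega>"
  then obtain k where k: "k \<in> {1..t}" "threshold_selects X k1 k2 k \<omega>" by blast
  then have "threshold_time N X k1 k2 \<omega> \<le> k"
    using assms by (intro threshold_time_props(4)) auto
  then show "threshold_time N X k1 k2 \<omega> \<le> t" using k by simp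
qed

lemma threshold_time_stopping: "threshold_time N X k1 k2 \<in> stopping_times M N X"
proof -
  have "Measurable.pred (rank_filtration M X t) (\<lambda>\<omega>. threshold_time N X k1 k2 \<omega> \<le> t)" for t
  proof -
    let ?F = "rank_filtration M X t"
    let ?G = "{Y i -` A \<inter> space M | i A. i \<in> {1..t}}"
    have sp: "space ?F = space M" by (auto simp: rank_filtration_def space_measure_of_conv)
    have G: "?G \<subseteq> Pow (space M)" by auto
    have rank_set: "Y k -` A \<inter> space M \<in> sets ?F" if "k \<in> {1..t}" for k A
      unfolding rank_filtration_def sets_measure_of[OF G] using that by (intro sigma_sets.Basic) blast
    have "{\<omega> \<in> space M. threshold_time N X k1 k2 \<omega> \<le> t} \<in> sets ?F"
    proof (cases "t < N")
      case True
      define R where "R = (\<lambda>k. {r :: nat. r = 1 \<and> k \<ge> k1 \<or> r = 2 \<and> k > k2})"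
      have "{\<omega> \<in> space M. threshold_time N X k1 k2 \<omega> \<le> t} = (\<Union>k\<in>{1..t}. Y k -` R k \<inter> space M)"
        using threshold_time_le_iff[OF _ True, of _ k1 k2]
        unfolding threshold_selects_def R_def by blast
      also have "\<dots> \<in> sets ?F" using rank_set by (intro sets.finite_UN) auto
      finally show ?thesis .
    next
      case False
      then have "{\<omega> \<in> space M. threshold_time N X k1 k2 \<omega> \<le> t} = space ?F"
        using threshold_time_props(1)[of _ k1 k2] unfolding sp by force
      then show ?thesis by simp
    qed
    then show ?thesis by (simp add: pred_def sp)
  qed
  then show ?thesis
    using threshold_time_props(1) by (auto simp: stopping_times_def stopping_time_def)
qed

text \<open>
  For the threshold time every Bellman inequality is an equality. At time \<open>N\<close>
  it may stop without having found an acceptable object, but this costs nothing since the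
  continuation value is 0 there.
\<close>
lemma threshold_gain_sum:
  fixes k1 k2 :: nat
  assumes thr: "threshold_pair N k1 k2" and "n \<le> N"
  defines "\<tau> \<equiv> threshold_time N X k1 k2"
  shows "(\<Sum>k\<in>{1..n}. gain \<tau> k) + cont_value N n * prob {\<omega> \<in> space M. n < \<tau> \<omega>} = cont_value N 0"
  using assms(2)
proof (induction n)
  case 0
  then show ?case
    using prob_positive_time[OF stopping_times_rank[OF threshold_time_stopping]] by (simp add: \<tau>_def)
next
  case (Suc n)
  define k where "k = Suc n"
  have k: "k \<in> {1..N}" "1 \<le> k" "k \<le> N" using Suc.prems by (auto simp: k_def)
  have stop: "threshold_selects X k1 k2 k \<omega> \<or> k = N" if "\<omega> \<in> space M" "\<tau> \<omega> = k" for \<omega>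
    using threshold_time_props(2)[OF that(1), of k1 k2] that(2) k unfolding \<tau>_def by (cases "k = N") auto
  have cont: "\<not> threshold_selects X k1 k2 k \<omega>" if "\<omega> \<in> space M" "k < \<tau> \<omega>" for \<omega>
    using threshold_time_props(3)[OF that(1) k(1), of k1 k2] that(2) unfolding \<tau>_def by simp
  have "gain \<tau> k + cont_value N k * prob {\<omega> \<in> space M. k < \<tau> \<omega>} =
      cont_value N n * prob {\<omega> \<in> space M. n < \<tau> \<omega>}"
    unfolding k_def
  proof (rule bellman_step(2))
    show "rank_stopping_time \<tau>" unfolding \<tau>_def by (rule stopping_times_rank[OF threshold_time_stopping])
    show "n < N" using Suc.prems by simp
    fix \<omega> assume \<omega>: "\<omega> \<in> space M"
    {
      assume "\<tau> \<omega> = Suc n" "Y (Suc n) \<omega> = 1"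
      then have "k1 \<le> k \<or> k = N"
        using stop[OF \<omega>] by (auto simp: threshold_selects_def k_def)
      then show "cont_value N (Suc n) \<le> best_duration N (Suc n)"
        using cont_le_best[OF thr, of k] k best_duration_last[OF N_pos] unfolding k_def[symmetric] by auto
    next
      assume "Suc n < \<tau> \<omega>" "Y (Suc n) \<omega> = 1"
      then have "k < k1" using cont[OF \<omega>] by (auto simp: threshold_selects_def k_def)
      then show "best_duration N (Suc n) \<le> cont_value N (Suc n)"
        using best_le_cont[OF thr, of k] k unfolding k_def[symmetric] by auto
    next
      assume "\<tau> \<omega> = Suc n" "Y (Suc n) \<omega> = 2"
      then have "k2 < k \<or> k = N"
        using stop[OF \<omega>] by (auto simp: threshold_selects_def k_def)
      then show "cont_value N (Suc n) \<le> second_duration N (Suc n)"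
        using cont_le_second[OF thr, of k] k second_duration_last[OF N_pos] unfolding k_def[symmetric] by auto
    next
      assume *: "Suc n < \<tau> \<omega>" "Y (Suc n) \<omega> = 2"
      then have "k \<le> k2" using cont[OF \<omega>] by (auto simp: threshold_selects_def k_def)
      moreover have "2 \<le> k" using relative_rank_bounds[OF k(1), of \<omega>] * by (simp add: k_def)
      ultimately show "second_duration N (Suc n) \<le> cont_value N (Suc n)"
        using second_le_cont[OF thr, of k] unfolding k_def[symmetric] by auto
    next
      assume "\<tau> \<omega> = Suc n" "3 \<le> Y (Suc n) \<omega>"
      then have "k = N" using stop[OF \<omega>] by (auto simp: threshold_selects_def k_def)
      then show "cont_value N (Suc n) = 0" by (simp add: k_def)
    }
  qed
  then show ?case using Suc by (simp add: k_def)
qed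

lemma threshold_time_optimal:
  assumes thr: "threshold_pair N k1 k2"
  shows "optimal_value M N X = cont_value N 0 / real N"
    and "optimal_stopping_time M N X (threshold_time N X k1 k2)"
proof -
  let ?\<tau> = "threshold_time N X k1 k2"
  have eq: "expectation (payoff N X ?\<tau>) = cont_value N 0 / real N"
    using threshold_gain_sum[OF thr, of N]
      expectation_payoff[OF stopping_times_rank[OF threshold_time_stopping[of k1 k2]]] by simp
  show val: "optimal_value M N X = cont_value N 0 / real N"
    unfolding optimal_value_def
  proof (rule cSup_eq_maximum)
    show "cont_value N 0 / real N \<in> (\<lambda>\<tau>. expectation (payoff N X \<tau>)) ` stopping_times M N X"
      using eq threshold_time_stopping[of k1 k2] by (metis image_eqI)
    fix x assume "x \<in> (\<lambda>\<tau>. expectation (payoff N X \<tau>)) ` stopping_times M N X"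
    then show "x \<le> cont_value N 0 / real N"
      using expectation_payoff_le[OF stopping_times_rank] by blast
  qed
  show "optimal_stopping_time M N X ?\<tau>"
    using eq val threshold_time_stopping by (simp add: optimal_stopping_time_def)
qed

end

section \<open>Optimal threshold_pair and their limits\<close>

theorem mainTheorem1:
  fixes M :: "nat \<Rightarrow> 'a measure" and X :: "nat \<Rightarrow> nat \<Rightarrow> 'a \<Rightarrow> nat"
  assumes "\<And>N. N \<ge> 1 \<Longrightarrow> uniform_random_permutation (M N) N (X N)"
  shows "\<exists>(k1 :: nat \<Rightarrow> nat) (k2 :: nat \<Rightarrow> nat).
           (\<forall>N\<ge>1. k1 N < k2 N \<and>
              optimal_stopping_time (M N) N (X N) (threshold_time N (X N) (k1 N) (k2 N))) \<and>
           (\<exists>a b v :: real.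
              (\<lambda>N. real (k1 N) / real N) \<longlonglongrightarrow> a \<and> a \<cong>\<^sub>6 0.120381 \<and>
              (\<lambda>N. real (k2 N) / real N) \<longlonglongrightarrow> b \<and> b \<cong>\<^sub>6 0.417188 \<and>
              (\<lambda>N. optimal_value (M N) N (X N)) \<longlonglongrightarrow> v \<and> v \<cong>\<^sub>6 0.403827)"
proof -
  have "\<exists>k1 k2. \<forall>N\<ge>1. threshold_pair N (k1 N) (k2 N)"
    using threshold_pair_exists by metis
  then obtain k1 k2 where thr: "\<And>N. 1 \<le> N \<Longrightarrow> threshold_pair N (k1 N) (k2 N)" by blast
  have ranking: "uniform_ranking (M N) N (X N)" if "1 \<le> N" for N
    using assms[OF that] that
    by (simp add: uniform_ranking_def uniform_ranking_axioms_def uniform_random_permutation_def)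
  have opt: "k1 N < k2 N \<and> optimal_stopping_time (M N) N (X N) (threshold_time N (X N) (k1 N) (k2 N))"
    if "1 \<le> N" for N
    using uniform_ranking.threshold_time_optimal(2)[OF ranking thr] thr[OF that] that
    by (simp add: threshold_pair_def)
  obtain a b :: real where a: "0.12038130 \<le> a" "a \<le> 0.12038131" "- 2 * ln a - 1 + a = cont_limit b a"
    and b: "0.41718835 \<le> b" "b \<le> 0.41718836" "3 * (1 - b) + 2 * ln b = 0"
    by (rule limit_constants_exist)
  have lim2: "(\<lambda>N. real (k2 N) / real N) \<longlonglongrightarrow> b"
    using b by (intro second_threshold_tendsto[of k1 k2] thr) auto
  have lim1: "(\<lambda>N. real (k1 N) / real N) \<longlonglongrightarrow> a"
    using a b by (intro best_threshold_tendsto[of k1 k2 b] thr lim2) auto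
  have "(\<lambda>N. cont_value N 0 / real N) \<longlonglongrightarrow> a * cont_limit b a"
    using a b by (intro cont_value_tendsto[of k1 k2] thr lim1 lim2) auto
  moreover have "\<forall>\<^sub>F N in sequentially. cont_value N 0 / real N = optimal_value (M N) N (X N)"
    using eventually_ge_at_top[of 1]
    by eventually_elim (use uniform_ranking.threshold_time_optimal(1)[OF ranking thr] in simp)
  ultimately have limv: "(\<lambda>N. optimal_value (M N) N (X N)) \<longlonglongrightarrow> a * cont_limit b a"
    by (rule Lim_transform_eventually)
  have "a \<cong>\<^sub>6 0.120381"
    by (rule rounds_to_six_decimalsI[where n = 120381]) (use a in \<open>auto simp: abs_less_iff\<close>)
  moreover have "b \<cong>\<^sub>6 0.417188"
    by (rule rounds_to_six_decimalsI[where n = 417188]) (use b in \<open>auto simp: abs_less_iff\<close>)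
  moreover have "a * cont_limit b a \<cong>\<^sub>6 0.403827"
  proof (rule rounds_to_six_decimalsI[where n = 403827])
    have l: "ln 0.12038130 \<le> ln a" "ln a \<le> ln 0.12038131" using a by auto
    have "- 2.1170910740 \<le> ln a"
      using ln_a_bounds(1) l(1) unfolding atLeastAtMost_iff by (blast intro: order_trans)
    moreover have "ln a \<le> - 2.1170909905"
      using ln_a_bounds(2) l(2) unfolding atLeastAtMost_iff by (blast intro: order_trans)
    ultimately have c: "3.354563 \<le> cont_limit b a" "cont_limit b a \<le> 3.354564"
      using a(1,2) unfolding a(3)[symmetric] by simp_all
    have "0.12038130 * 3.354563 \<le> a * cont_limit b a"
      by (rule mult_mono) (use a(1,2) c in simp_all)
    moreover have "a * cont_limit b a \<le> 0.12038131 * 3.354564"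
      by (rule mult_mono) (use a(1,2) c in simp_all)
    ultimately show "\<bar>10 ^ 6 * (a * cont_limit b a) - real_of_int 403827\<bar> < 1 / 2"
      by (auto simp: abs_less_iff)
  qed simp
  ultimately show ?thesis
    using opt lim1 lim2 limv by blast
qed

end
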